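(* Let $\beta>\pi/2$ and let $\Omega_\beta\subset\mathbb{C}^2$ be the $\beta$-worm domain (defined in the context). Then the Diederich--Fornæss index of $\Omega_\beta$ is $\dfrac{\pi}{2\beta}$.
   Context: **Worm domain.** The $\beta$-worm domain is $$\Omega_\beta=\Big\{(z,w)\in\mathbb{C}^2:\ \big|z-e^{i\log|w|^2}\big|^2<1-\eta(\log|w|^2)\Big\},$$ where $\eta:\mathbb{R}\to\mathbb{R}$ is a fixed smooth function such that: (1) $\eta(x)\ge0$, and $\eta$ is even and convex; (2) $\eta^{-1}(0)=[-\beta+\pi/2,\ \beta-\pi/2]$; (3) there exists $a>0$ such that $\eta(x)>1$ if $x<-a$ or $x>a$; (4) $\eta'(x)\ne0$ if $\eta(x)=1$. This is a bounded pseudoconvex domain with smooth boundary. **Diederich--Fornæss index.** For a bounded pseudoconvex domain $\Omega\subset\mathbb{C}^n$ with $C^2$ boundary, a defining function is a real function $\rho$ which is $C^2$ on a neighborhood of $\overline\Omega$, with $\Omega=\{z\in\mathbb{C}^n:\rho(z)<0\}$ and $\nabla\rho\ne0$ on $\partial\Omega$. A number $0<\tau_\rho<1$ is a Diederich--Fornæss exponent if there is a defining function $\rho$ of $\Omega$ such that $-(-\rho)^{\tau_\rho}$ is plurisubharmonic in $\Omega$. The Diederich--Fornæss index of $\Omega$ is $\sup\tau_\rho$, the supremum being taken over all defining functions of $\Omega$ (and all such exponents). *)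

theory Defs
  imports "HOL-Analysis.Analysis"
begin

definition C2_on :: "'a::real_normed_vector set \<Rightarrow> ('a \<Rightarrow> real) \<Rightarrow> bool" where
  "C2_on U f \<longleftrightarrow>
     (\<exists>(f' :: 'a \<Rightarrow> 'a \<Rightarrow>\<^sub>L real) (f'' :: 'a \<Rightarrow> 'a \<Rightarrow>\<^sub>L ('a \<Rightarrow>\<^sub>L real)).
        (\<forall>x\<in>U. (f has_derivative blinfun_apply (f' x)) (at x) \<and>
               (f' has_derivative blinfun_apply (f'' x)) (at x)) \<and>
        continuous_on U f'')"

definition upper_semicontinuous_on :: "'a::topological_space set \<Rightarrow> ('a \<Rightarrow> real) \<Rightarrow> bool" where
  "upper_semicontinuous_on S u \<longleftrightarrow> (\<forall>c. openin (top_of_set S) {x\<in>S. u x < c})"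

text \<open>For a finite-valued upper semicontinuous function, the mean value inequality on a circle
  (with the mean in \<open>[-\<infinity>, \<infinity>)\<close>) forces the mean to be finite. Integrability on
  circles is therefore part of the property; it has to be stated because \<open>integral\<close> is
  \<open>0\<close> for non-integrable functions.\<close>

definition subharmonic_on :: "complex set \<Rightarrow> (complex \<Rightarrow> real) \<Rightarrow> bool" where
  "subharmonic_on V u \<longleftrightarrow>
     upper_semicontinuous_on V u \<and>
     (\<forall>a r. 0 < r \<longrightarrow> cball a r \<subseteq> V \<longrightarrow>
        (\<lambda>t. u (a + of_real r * cis t)) absolutely_integrable_on {0..2 * pi} \<and>
        u a \<le> integral {0..2 * pi} (\<lambda>t. u (a + of_real r * cis t)) / (2 * pi))"

definition plurisubharmonic_on :: "(complex ^ 'n::finite) set \<Rightarrow> (complex ^ 'n \<Rightarrow> real) \<Rightarrow> bool" where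
  "plurisubharmonic_on \<Omega> u \<longleftrightarrow>
     upper_semicontinuous_on \<Omega> u \<and>
     (\<forall>a\<in>\<Omega>. \<forall>b. subharmonic_on {\<zeta>. a + \<zeta> *s b \<in> \<Omega>} (\<lambda>\<zeta>. u (a + \<zeta> *s b)))"

text \<open>The values of \<open>\<rho>\<close> away from a neighbourhood of \<open>closure \<Omega>\<close> are constrained only
  by being nonnegative, so nothing is lost by taking \<open>\<rho>\<close> to be total.\<close>

definition defining_function :: "(complex ^ 'n::finite) set \<Rightarrow> (complex ^ 'n \<Rightarrow> real) \<Rightarrow> bool" where
  "defining_function \<Omega> \<rho> \<longleftrightarrow>
     (\<exists>U. open U \<and> closure \<Omega> \<subseteq> U \<and> C2_on U \<rho>) \<and>
     \<Omega> = {z. \<rho> z < 0} \<and>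
     (\<forall>z\<in>frontier \<Omega>. \<exists>g. GDERIV \<rho> z :> g \<and> g \<noteq> 0)"

definition DF_exponent :: "(complex ^ 'n::finite) set \<Rightarrow> real \<Rightarrow> bool" where
  "DF_exponent \<Omega> \<tau> \<longleftrightarrow>
     0 < \<tau> \<and> \<tau> < 1 \<and>
     (\<exists>\<rho>. defining_function \<Omega> \<rho> \<and> plurisubharmonic_on \<Omega> (\<lambda>z. - ((- \<rho> z) powr \<tau>)))"

text \<open>The supremum is taken in \<open>ereal\<close>, so that it is also well defined (namely
  \<open>-\<infinity>\<close>) for sets without any exponent. Intended for bounded pseudoconvex domains with
  \<open>C\<^sup>2\<close> boundary.\<close>

definition DF_index :: "(complex ^ 'n::finite) set \<Rightarrow> ereal" where
  "DF_index \<Omega> = (SUP \<tau>\<in>{\<tau>. DF_exponent \<Omega> \<tau>}. ereal \<tau>)"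

definition worm_profile :: "real \<Rightarrow> (real \<Rightarrow> real) \<Rightarrow> bool" where
  "worm_profile \<beta> \<eta> \<longleftrightarrow>
     (\<forall>k. (deriv ^^ k) \<eta> differentiable_on UNIV) \<and>
     (\<forall>x. 0 \<le> \<eta> x) \<and> (\<forall>x. \<eta> (- x) = \<eta> x) \<and> convex_on UNIV \<eta> \<and>
     \<eta> -` {0} = {- \<beta> + pi / 2 .. \<beta> - pi / 2} \<and>
     (\<exists>a>0. \<forall>x. x < - a \<or> x > a \<longrightarrow> \<eta> x > 1) \<and>
     (\<forall>x. \<eta> x = 1 \<longrightarrow> deriv \<eta> x \<noteq> 0)"

text \<open>Points with \<open>w = 0\<close> are not in the domain; they are excluded explicitly because
  \<open>ln 0 = 0\<close> in HOL.\<close>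

definition worm_domain :: "(real \<Rightarrow> real) \<Rightarrow> (complex ^ 2) set" where
  "worm_domain \<eta> =
     {p. p $ 2 \<noteq> 0 \<and>
         (cmod (p $ 1 - exp (\<i> * of_real (ln ((cmod (p $ 2))\<^sup>2)))))\<^sup>2
           < 1 - \<eta> (ln ((cmod (p $ 2))\<^sup>2))}"

end

theory Submission
  imports Defs
begin

text \<open>Write \<open>s = log |w|\<^sup>2\<close>.

  Upper bound. Let \<open>- (- \<rho>) powr \<tau>\<close> be plurisubharmonic and suppose
  \<open>pi / (2 \<beta>) < \<kappa> < \<sigma> < \<tau>\<close>. On the holomorphic curve \<open>z = exp \<xi>\<close>, \<open>w = exp (- \<i> (1 - \<kappa>) \<xi> / 2)\<close>
  the function \<open>(- \<rho>) powr \<tau>\<close> is positive and superharmonic for \<open>\<bar>Im \<xi>\<bar> \<le> pi / (2 \<sigma>)\<close> and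
  \<open>Re \<xi>\<close> below some bound. By the minimum principle it dominates a multiple of the harmonic function
  \<open>Re (exp (\<sigma> \<xi>))\<close>, which vanishes on the sides of this strip. But \<open>- \<rho>\<close> is at most a multiple of
  \<open>|z| = exp (Re \<xi>)\<close> for real \<open>\<xi>\<close>, which is impossible as \<open>Re \<xi>\<close> tends to \<open>-\<infinity>\<close> because \<open>\<sigma> < \<tau>\<close>.

  Lower bound. For \<open>\<tau> < pi / (2 \<beta>)\<close> and \<open>\<mu> = \<tau> / (1 - \<tau>)\<close> the weight \<open>C = cos (\<mu> s) + K \<eta> s\<close> is positive
  for large \<open>K\<close>, and with the standard defining function \<open>- r\<close> the function \<open>- (r * C powr (1/\<mu>)) powr \<tau>\<close> is
  plurisubharmonic near the boundary. A concave cut-off makes it constant in the rest of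
  the domain.\<close>

text \<open>Both halves yield the same number because the boundary contains the annulus
  \<open>z = 0\<close>, |s| \<le> \<beta> - pi/2. On the curve of the upper bound the disc condition
  asks for cos (\<kappa> \<theta>) > 0, and at |\<theta>| = pi/(2\<kappa>) one has |s| =
  pi/(2\<kappa>) - pi/2, which lies below \<beta> - pi/2 exactly when \<kappa> > pi/(2\<beta>). The
  gap \<kappa> < \<sigma> keeps that cosine away from 0 on the closed strip, so that a whole
  half-strip enters the domain; the gap \<sigma> < \<tau> separates the two rates of decay. As
  \<rho> is arbitrary, only its sign, its linear bound at the boundary and plurisubharmonicity are
  available.

  For the lower bound, \<eta> and \<eta>'' vanish over the annulus, so it is the weight exp
  (-\<psi>) that must give \<psi>'' \<ge> \<mu> (1 + \<psi>'^2) there. Then arctan \<psi>' grows at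
  least at rate \<mu>, so an interval of solutions has length at most pi/\<mu> = pi/\<tau> - pi;
  this exceeds the length 2\<beta> - pi of the annulus in s exactly when \<tau> <
  pi/(2\<beta>).\<close>

section \<open>Functions with two continuous derivatives\<close>

text \<open>\<open>C2_on\<close> hides its derivatives, but Laplacians and Levi forms are computed
  from them, so they are carried along explicitly. The codomain is general because holomorphic
  curves are composed with real functions.\<close>

definition jet2 ::
  "'a::real_normed_vector set \<Rightarrow> ('a \<Rightarrow> 'b::real_normed_vector) \<Rightarrow> ('a \<Rightarrow> 'a \<Rightarrow>\<^sub>L 'b) \<Rightarrow>
    ('a \<Rightarrow> 'a \<Rightarrow>\<^sub>L ('a \<Rightarrow>\<^sub>L 'b)) \<Rightarrow> bool" where
  "jet2 U f f' f'' \<longleftrightarrow>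
     (\<forall>x\<in>U. (f has_derivative blinfun_apply (f' x)) (at x) \<and>
            (f' has_derivative blinfun_apply (f'' x)) (at x)) \<and>
     continuous_on U f''"

lemma C2_on_iff_jet2: "C2_on U f \<longleftrightarrow> (\<exists>f' f''. jet2 U f f' f'')"
  by (simp add: C2_on_def jet2_def)

lemma jet2_D1: "jet2 U f f' f'' \<Longrightarrow> x \<in> U \<Longrightarrow> (f has_derivative blinfun_apply (f' x)) (at x)"
  and jet2_D2: "jet2 U f f' f'' \<Longrightarrow> x \<in> U \<Longrightarrow> (f' has_derivative blinfun_apply (f'' x)) (at x)"
  and jet2_cont2: "jet2 U f f' f'' \<Longrightarrow> continuous_on U f''"
  by (auto simp: jet2_def)

lemma jet2_cont0: "jet2 U f f' f'' \<Longrightarrow> continuous_on U f"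
  by (meson continuous_at_imp_continuous_on has_derivative_continuous jet2_D1)

lemma jet2_cont1: "jet2 U f f' f'' \<Longrightarrow> continuous_on U f'"
  by (meson continuous_at_imp_continuous_on has_derivative_continuous jet2_D2)

lemma jet2_subset: "jet2 U f f' f'' \<Longrightarrow> V \<subseteq> U \<Longrightarrow> jet2 V f f' f''"
  unfolding jet2_def using continuous_on_subset by blast

lemma jet2_cong:
  assumes "jet2 U f f' f''" "open U" "\<And>x. x \<in> U \<Longrightarrow> g x = f x"
  shows "jet2 U g f' f''"
  using assms unfolding jet2_def
  by (metis has_derivative_transform_within_open)

lemma jet2_bounded_linear:
  assumes "bounded_linear f"
  shows "jet2 U f (\<lambda>_. Blinfun f) (\<lambda>_. 0)"
  unfolding jet2_def
  by (auto simp: bounded_linear_Blinfun_apply[OF assms] bounded_linear_imp_has_derivative[OF assms]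
      zero_blinfun.rep_eq)

lemma jet2_const: "jet2 U (\<lambda>_. c) (\<lambda>_. 0) (\<lambda>_. 0)"
  by (auto simp: jet2_def zero_blinfun.rep_eq)

lemma jet2_add:
  assumes "jet2 U f f' f''" "jet2 U g g' g''"
  shows "jet2 U (\<lambda>x. f x + g x) (\<lambda>x. f' x + g' x) (\<lambda>x. f'' x + g'' x)"
  using assms unfolding jet2_def
  by (auto intro!: derivative_eq_intros continuous_intros simp: blinfun.add_left)

lemma jet2_cmult:
  fixes f :: "'a::real_normed_vector \<Rightarrow> real"
  assumes "jet2 U f f' f''"
  shows "jet2 U (\<lambda>x. c * f x) (\<lambda>x. c *\<^sub>R f' x) (\<lambda>x. c *\<^sub>R f'' x)"
  using assms unfolding jet2_def
  by (auto intro!: derivative_eq_intros continuous_intros simp: blinfun.scaleR_left)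

interpretation blinfun_compose: bounded_bilinear "(o\<^sub>L)"
  by (rule bounded_bilinear_blinfun_compose)

lemma jet2_compose:
  assumes f: "jet2 U f f' f''" and g: "jet2 V g g' g''" and sub: "f ` U \<subseteq> V"
  shows "jet2 U (\<lambda>x. g (f x)) (\<lambda>x. g' (f x) o\<^sub>L f' x)
     (\<lambda>x. (blinfun_compose.prod_left (f' x) o\<^sub>L (g'' (f x) o\<^sub>L f' x)) +
          (blinfun_compose.prod_right (g' (f x)) o\<^sub>L f'' x))"
  unfolding jet2_def
proof (intro conjI ballI)
  fix x assume x: "x \<in> U"
  then have fx: "f x \<in> V" using sub by auto
  show "((\<lambda>x. g (f x)) has_derivative blinfun_apply (g' (f x) o\<^sub>L f' x)) (at x)"
    using has_derivative_compose[OF jet2_D1[OF f x] jet2_D1[OF g fx]]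
    by (rule has_derivative_eq_rhs) (simp add: fun_eq_iff)
  have "((\<lambda>x. g' (f x)) has_derivative (\<lambda>v. g'' (f x) (f' x v))) (at x)"
    using has_derivative_compose[OF jet2_D1[OF f x] jet2_D2[OF g fx]] by simp
  from blinfun_compose.FDERIV[OF this jet2_D2[OF f x]]
  show "((\<lambda>x. g' (f x) o\<^sub>L f' x) has_derivative
     blinfun_apply ((blinfun_compose.prod_left (f' x) o\<^sub>L (g'' (f x) o\<^sub>L f' x)) +
          (blinfun_compose.prod_right (g' (f x)) o\<^sub>L f'' x))) (at x)"
    by (rule has_derivative_eq_rhs)
      (auto simp: fun_eq_iff blinfun.add_left blinfun_compose.prod_left.rep_eq
        blinfun_compose.prod_right.rep_eq)
next
  have c: "continuous_on U (\<lambda>x. g' (f x))" "continuous_on U (\<lambda>x. g'' (f x))"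
    by (auto intro: continuous_on_compose2[OF jet2_cont1[OF g] jet2_cont0[OF f] sub]
        continuous_on_compose2[OF jet2_cont2[OF g] jet2_cont0[OF f] sub])
  show "continuous_on U
     (\<lambda>x. (blinfun_compose.prod_left (f' x) o\<^sub>L (g'' (f x) o\<^sub>L f' x)) +
          (blinfun_compose.prod_right (g' (f x)) o\<^sub>L f'' x))"
    by (intro continuous_intros c jet2_cont1[OF f] jet2_cont2[OF f]
        bounded_linear.continuous_on[OF blinfun_compose.bounded_linear_prod_left]
        bounded_linear.continuous_on[OF blinfun_compose.bounded_linear_prod_right])
qed

lemma jet2_real:
  fixes h h1 h2 :: "real \<Rightarrow> real"
  assumes "\<And>t. t \<in> T \<Longrightarrow> (h has_real_derivative h1 t) (at t)"
    and "\<And>t. t \<in> T \<Longrightarrow> (h1 has_real_derivative h2 t) (at t)"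
    and "continuous_on T h2"
  shows "jet2 T h (\<lambda>t. blinfun_scaleR_left (h1 t))
           (\<lambda>t. blinfun_scaleR_left (blinfun_scaleR_left (h2 t)))"
proof -
  have "((\<lambda>t. blinfun_scaleR_left (h1 t)) has_derivative
      blinfun_apply (blinfun_scaleR_left (blinfun_scaleR_left (h2 t)))) (at t)" if "t \<in> T" for t
  proof -
    have "(h1 has_derivative (\<lambda>v. v * h2 t)) (at t)"
      using assms(2)[OF that] by (simp add: has_field_derivative_def mult_commute_abs)
    from bounded_linear.has_derivative[OF bounded_linear_blinfun_scaleR_left this]
    show ?thesis
      by (rule has_derivative_eq_rhs)
        (auto simp: fun_eq_iff blinfun.scaleR_left intro!: blinfun_eqI)
  qed
  moreover have "(h has_derivative blinfun_apply (blinfun_scaleR_left (h1 t))) (at t)"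
    if "t \<in> T" for t
    using assms(1)[OF that] by (simp add: has_field_derivative_def mult_commute_abs)
  moreover have "continuous_on T (\<lambda>t. blinfun_scaleR_left (blinfun_scaleR_left (h2 t)) :: real \<Rightarrow>\<^sub>L real \<Rightarrow>\<^sub>L real)"
    using assms(3)
    by (intro bounded_linear.continuous_on[OF bounded_linear_blinfun_scaleR_left])
  ultimately show ?thesis by (auto simp: jet2_def)
qed

text \<open>Derivatives at a point are unique, so the chosen ones agree with every local jet. This
  serves the defining function of the lower bound, which has different formulas on two overlapping
  open sets.\<close>

lemma jet2_glue:
  fixes f :: "'a::euclidean_space \<Rightarrow> 'b::real_normed_vector"
  assumes "\<And>x. x \<in> U \<Longrightarrow> \<exists>V f' f''. open V \<and> x \<in> V \<and> jet2 V f f' f''"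
  shows "\<exists>f' f''. jet2 U f f' f''"
proof -
  define F' where "F' x = (SOME D. (f has_derivative blinfun_apply D) (at x))" for x
  define F'' where "F'' x = (SOME D. (F' has_derivative blinfun_apply D) (at x))" for x
  have main: "(\<forall>x\<in>V. F' x = f' x) \<and> (\<forall>x\<in>V. F'' x = f'' x) \<and> jet2 V f F' F''"
    if V: "open V" "jet2 V f f' f''" for V f' f''
  proof -
    have 1: "F' x = f' x" if x: "x \<in> V" for x
    proof -
      have "(f has_derivative blinfun_apply (F' x)) (at x)"
        unfolding F'_def by (rule someI[of _ "f' x"]) (rule jet2_D1[OF V(2) x])
      from has_derivative_unique[OF this jet2_D1[OF V(2) x]] show ?thesis
        by (simp add: blinfun_apply_inject)
    qed
    have 2: "(F' has_derivative blinfun_apply (f'' x)) (at x)" if x: "x \<in> V" for x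
      using has_derivative_transform_within_open[OF jet2_D2[OF V(2) x] V(1) x] 1 by auto
    have 3: "F'' x = f'' x" if x: "x \<in> V" for x
    proof -
      have "(F' has_derivative blinfun_apply (F'' x)) (at x)"
        unfolding F''_def by (rule someI[of _ "f'' x"]) (rule 2[OF x])
      from has_derivative_unique[OF this 2[OF x]] show ?thesis
        by (simp add: blinfun_apply_inject)
    qed
    show ?thesis
      using V(2) 1 2 3 by (auto simp: jet2_def cong: continuous_on_cong)
  qed
  have "jet2 U f F' F''"
    unfolding jet2_def
  proof (intro conjI ballI)
    fix x assume "x \<in> U"
    from assms[OF this] main obtain V where "open V" "x \<in> V" "jet2 V f F' F''" by metis
    then show "(f has_derivative blinfun_apply (F' x)) (at x)"
      "(F' has_derivative blinfun_apply (F'' x)) (at x)"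
      by (auto simp: jet2_def)
  next
    show "continuous_on U F''"
    proof (intro continuous_at_imp_continuous_on ballI)
      fix x assume "x \<in> U"
      from assms[OF this] main obtain V where "open V" "x \<in> V" "jet2 V f F' F''" by metis
      then show "isCont F'' x"
        by (meson jet2_cont2 continuous_on_eq_continuous_at)
    qed
  qed
  then show ?thesis by blast
qed

section \<open>Mean value inequalities and the maximum principle\<close>

text \<open>With \<open>M \<rho>\<close> the circular integral, \<open>\<rho> (\<rho> M')'\<close> is the integral of
  \<open>\<rho>\<^sup>2 \<Delta>f\<close>, since the angular part of the Laplacian integrates to zero. So \<open>\<rho> M'\<close>,
  which vanishes at \<open>0\<close>, is nondecreasing.\<close>

lemma mean_value_le_of_laplacian_nonneg:
  fixes f :: "complex \<Rightarrow> real"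
  assumes j: "jet2 V f f' f''"
    and lap: "\<And>x e. x \<in> V \<Longrightarrow> f'' x e e + f'' x (\<i> * e) (\<i> * e) \<ge> 0"
    and r: "0 < r" "cball a r \<subseteq> V"
  shows "f a \<le> integral {0..2*pi} (\<lambda>t. f (a + of_real r * cis t)) / (2*pi)"
proof -
  let ?p = "\<lambda>x t. a + complex_of_real x * cis t"
  have inV: "?p x t \<in> V" if "x \<in> {0..r}" for x t
    using that r by (intro subsetD[OF r(2)]) (auto simp: dist_norm norm_mult)
  define M where "M x = integral (cbox 0 (2*pi)) (\<lambda>t. f (?p x t))" for x
  define N where "N x = integral (cbox 0 (2*pi)) (\<lambda>t. f' (?p x t) (of_real x * cis t))" for x
  define M1 where "M1 x = integral (cbox 0 (2*pi)) (\<lambda>t. f' (?p x t) (cis t))" for x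
  define N1 where "N1 x = integral (cbox 0 (2*pi))
      (\<lambda>t. f'' (?p x t) (cis t) (of_real x * cis t) + f' (?p x t) (cis t))" for x
  have cp: "continuous_on ({0..r} \<times> cbox 0 (2*pi)) (\<lambda>z. ?p (fst z) (snd z))"
    by (intro continuous_intros)
  have sub: "(\<lambda>z. ?p (fst z) (snd z)) ` ({0..r} \<times> cbox 0 (2*pi)) \<subseteq> V" 
    using inV by auto
  note c1 = continuous_on_compose2[OF jet2_cont1[OF j] cp sub]
  note c2 = continuous_on_compose2[OF jet2_cont2[OF j] cp sub]
  have cpx: "continuous_on (cbox 0 (2*pi)) (\<lambda>t. ?p x t)" for x
    by (intro continuous_intros)
  have subx: "x \<in> {0..r} \<Longrightarrow> (\<lambda>t. ?p x t) ` (cbox 0 (2*pi)) \<subseteq> V" for x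
    using inV by auto
  note d0 = continuous_on_compose2[OF jet2_cont0[OF j] cpx subx]
  note d1 = continuous_on_compose2[OF jet2_cont1[OF j] cpx subx]
  note d2 = continuous_on_compose2[OF jet2_cont2[OF j] cpx subx]
  have dp: "((\<lambda>x. ?p x t) has_vector_derivative cis t) (at x within S)" for x t S
    unfolding has_vector_derivative_def
    by (auto intro!: derivative_eq_intros simp: scaleR_conv_of_real)
  have M': "(M has_real_derivative M1 x) (at x within {0..r})" if x: "x \<in> {0..r}" for x
    unfolding M_def M1_def
  proof (rule leibniz_rule_field_derivative[OF _ _ _ x])
    fix x t assume x: "x \<in> {0..r}"
    have "((\<lambda>x. f (?p x t)) has_vector_derivative f' (?p x t) (cis t)) (at x within {0..r})"
      using vector_derivative_diff_chain_within[OF dp, of f "f' (?p x t)"]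
        has_derivative_at_withinI[OF jet2_D1[OF j inV[OF x]]] by (simp add: o_def)
    then show "((\<lambda>x. f (?p x t)) has_real_derivative f' (?p x t) (cis t)) (at x within {0..r})"
      by (simp add: has_real_derivative_iff_has_vector_derivative)
  next
    fix x assume "x \<in> {0..r}"
    then show "(\<lambda>t. f (?p x t)) integrable_on cbox 0 (2*pi)"
      by (intro integrable_continuous d0)
  next
    show "continuous_on ({0..r} \<times> cbox 0 (2*pi)) (\<lambda>(x, t). f' (?p x t) (cis t))"
      unfolding split_beta by (intro continuous_intros c1)
  qed simp
  have N': "(N has_real_derivative N1 x) (at x within {0..r})" if x: "x \<in> {0..r}" for x
    unfolding N_def N1_def
  proof (rule leibniz_rule_field_derivative[OF _ _ _ x])
    fix x t assume x: "x \<in> {0..r}"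
    have 1: "((\<lambda>x. f' (?p x t)) has_vector_derivative f'' (?p x t) (cis t)) (at x within {0..r})"
      using vector_derivative_diff_chain_within[OF dp, of f' "f'' (?p x t)"]
        has_derivative_at_withinI[OF jet2_D2[OF j inV[OF x]]] by (simp add: o_def)
    have 2: "((\<lambda>x. of_real x * cis t) has_vector_derivative cis t) (at x within {0..r})"
      unfolding has_vector_derivative_def
      by (auto intro!: derivative_eq_intros simp: scaleR_conv_of_real)
    show "((\<lambda>x. f' (?p x t) (of_real x * cis t)) has_real_derivative 
         f'' (?p x t) (cis t) (of_real x * cis t) + f' (?p x t) (cis t)) (at x within {0..r})"
      using bounded_bilinear.has_vector_derivative[OF bounded_bilinear_blinfun_apply 1 2]
      by (simp add: has_real_derivative_iff_has_vector_derivative add.commute)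
  next
    fix x assume "x \<in> {0..r}"
    then show "(\<lambda>t. f' (?p x t) (of_real x * cis t)) integrable_on cbox 0 (2*pi)"
      by (intro integrable_continuous continuous_intros d1)
  next
    show "continuous_on ({0..r} \<times> cbox 0 (2*pi))
       (\<lambda>(x, t). f'' (?p x t) (cis t) (of_real x * cis t) + f' (?p x t) (cis t))"
      unfolding split_beta by (intro continuous_intros c1 c2)
  qed simp
  have NM: "N x = x * M1 x" for x
    unfolding N_def M1_def 
    by (simp add: blinfun.scaleR_right flip: scaleR_conv_of_real)
  have N1: "N1 x \<ge> 0" if x: "x \<in> {0..r}" "x > 0" for x
  proof -
    \<comment> \<open>\<open>?A\<close> is the derivative in \<open>t\<close> of \<open>f'\<close>
      applied to the tangent vector of the circle. The tangent closes up after one turn, so the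
      integral of \<open>?A\<close> is 0.\<close>
    let ?A = "\<lambda>t. f'' (?p x t) (\<i> * of_real x * cis t) (\<i> * of_real x * cis t)
         + f' (?p x t) (- of_real x * cis t)"
    have "(?A has_integral (f' (?p x (2*pi)) (\<i> * of_real x * cis (2*pi))
        - f' (?p x 0) (\<i> * of_real x * cis 0))) {0..2*pi}"
    proof (rule fundamental_theorem_of_calculus)
      fix t :: real
      have dc: "(cis has_vector_derivative \<i> * cis t) (at t within S)" for t :: real and S
        unfolding has_vector_derivative_def
        by (auto intro!: derivative_eq_intros simp: scaleR_conv_of_real)
      have 0: "((\<lambda>t. ?p x t) has_vector_derivative \<i> * of_real x * cis t) (at t within {0..2*pi})"
        by (auto intro!: derivative_eq_intros dc)
      have "((\<lambda>t. \<i> * of_real x * cis t) has_vector_derivative \<i> * of_real x * (\<i> * cis t))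
          (at t within {0..2*pi})"
        by (intro derivative_intros dc)
      moreover have "\<i> * of_real x * (\<i> * cis t) = - of_real x * cis t"
        by (simp add: complex_eq_iff)
      ultimately have 2: "((\<lambda>t. \<i> * of_real x * cis t) has_vector_derivative - of_real x * cis t)
          (at t within {0..2*pi})"
        by simp
      have 1: "((\<lambda>t. f' (?p x t)) has_vector_derivative f'' (?p x t) (\<i> * of_real x * cis t))
          (at t within {0..2*pi})"
        using vector_derivative_diff_chain_within[OF 0, of f' "f'' (?p x t)"]
          has_derivative_at_withinI[OF jet2_D2[OF j inV[OF x(1)]]] by (simp add: o_def)
      show "((\<lambda>t. f' (?p x t) (\<i> * of_real x * cis t)) has_vector_derivative ?A t)
          (at t within {0..2*pi})"
        using bounded_bilinear.has_vector_derivative[OF bounded_bilinear_blinfun_apply 1 2]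
        by (simp add: add.commute)
    qed simp
    then have A: "(?A has_integral 0) (cbox 0 (2*pi))" by simp
    have "((\<lambda>t. f'' (?p x t) (cis t) (of_real x * cis t) + f' (?p x t) (cis t)) has_integral N1 x)
        (cbox 0 (2*pi))"
      unfolding N1_def
      using x by (intro integrable_integral integrable_continuous continuous_intros d1 d2)
    from has_integral_add[OF has_integral_mult_right[OF this, of x] A]
    have I: "((\<lambda>t. x * (f'' (?p x t) (cis t) (of_real x * cis t) + f' (?p x t) (cis t)) + ?A t)
        has_integral x * N1 x) (cbox 0 (2*pi))" by simp
    have "x * (f'' (?p x t) (cis t) (of_real x * cis t) + f' (?p x t) (cis t)) + ?A t =
        f'' (?p x t) (of_real x * cis t) (of_real x * cis t)
        + f'' (?p x t) (\<i> * (of_real x * cis t)) (\<i> * (of_real x * cis t))" for t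
    proof -
      have v: "of_real x * cis t = x *\<^sub>R cis t" "- of_real x * cis t = - (x *\<^sub>R cis t)"
        "\<i> * of_real x * cis t = \<i> * (x *\<^sub>R cis t)"
        by (simp_all add: scaleR_conv_of_real)
      show ?thesis
        unfolding v by (simp add: blinfun.bilinear_simps distrib_left)
    qed
    then have "((\<lambda>t. f'' (?p x t) (of_real x * cis t) (of_real x * cis t)
        + f'' (?p x t) (\<i> * (of_real x * cis t)) (\<i> * (of_real x * cis t))) has_integral x * N1 x)
        (cbox 0 (2*pi))"
      using I by (simp only:)
    from has_integral_nonneg[OF this] lap inV[OF x(1)] have "x * N1 x \<ge> 0" by auto
    with x show ?thesis by (simp add: zero_le_mult_iff)
  qed
  \<comment> \<open>The sign of \<open>G\<close> is available only at positive radius, since it is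
    obtained by dividing by \<open>x\<close>; at 0 continuity of \<open>F\<close> suffices.\<close>
  have pos: "F 0 \<le> F x"
    if x: "x \<in> {0..r}" and F: "\<And>x. x \<in> {0..r} \<Longrightarrow> (F has_real_derivative G x) (at x within {0..r})"
      and G: "\<And>x. x \<in> {0..r} \<Longrightarrow> x > 0 \<Longrightarrow> G x \<ge> 0" for F G x
  proof (rule DERIV_nonneg_imp_increasing_open[of 0 x F])
    fix y assume y: "0 < y" "y < x"
    then have "at y within {0..r} = at y"
      using x by (intro at_within_interior) auto
    then have "(F has_real_derivative G y) (at y)" "0 \<le> G y"
      using F[of y] G[of y] x y by simp_all
    then show "\<exists>d. (F has_real_derivative d) (at y) \<and> 0 \<le> d" by blast
  next
    show "continuous_on {0..x} F"
      using x by (intro continuous_on_subset[OF DERIV_continuous_on[OF F]]) auto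
  qed (use x in auto)
  have "N 0 \<le> N x" if "x \<in> {0..r}" for x
    by (rule pos[OF that N' N1])
  then have "x * M1 x \<ge> 0" if "x \<in> {0..r}" for x
    using that by (simp add: NM)
  then have "M1 x \<ge> 0" if "x \<in> {0..r}" "x > 0" for x
    using that zero_le_mult_iff[of x "M1 x"] by (metis leD)
  then have "M 0 \<le> M r"
    using r by (intro pos[OF _ M']) auto
  then show ?thesis
    by (simp add: M_def field_simps)
qed

text \<open>The mixed terms \<open>B 1 \<i>\<close> and \<open>B \<i> 1\<close> cancel between the
  two summands. Hence a sign in the directions \<open>1\<close> and \<open>\<i>\<close> gives the
  sign for every \<open>e\<close>.\<close>

lemma laplacian_rotate:
  fixes B :: "complex \<Rightarrow>\<^sub>L complex \<Rightarrow>\<^sub>L real"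
  shows "B e e + B (\<i> * e) (\<i> * e) = (cmod e)\<^sup>2 * (B 1 1 + B \<i> \<i>)"
proof -
  have e: "e = Re e *\<^sub>R 1 + Im e *\<^sub>R \<i>" "\<i> * e = (- Im e) *\<^sub>R 1 + Re e *\<^sub>R \<i>"
    by (auto simp: complex_eq_iff)
  show ?thesis
    unfolding e(2) by (subst (1 2) e(1), unfold cmod_power2)
      (simp add: blinfun.bilinear_simps algebra_simps power2_eq_square)
qed

lemma jet2_dist_square:
  fixes a :: "'a::real_inner"
  shows "jet2 U (\<lambda>x. c * (norm (x - a))\<^sup>2) (\<lambda>x. (2 * c) *\<^sub>R blinfun_inner_left (x - a))
     (\<lambda>_. (2 * c) *\<^sub>R Blinfun blinfun_inner_left)"
  unfolding jet2_def
proof (intro conjI ballI)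
  fix x
  have bl: "bounded_linear (blinfun_inner_left :: 'a \<Rightarrow> 'a \<Rightarrow>\<^sub>L real)"
    by (rule bounded_linear_blinfun_inner_left)
  have "((\<lambda>x. c * ((x - a) \<bullet> (x - a))) has_derivative
      blinfun_apply ((2 * c) *\<^sub>R blinfun_inner_left (x - a))) (at x)"
    by (auto intro!: derivative_eq_intros
        simp: fun_eq_iff blinfun.scaleR_left inner_commute)
  then show "((\<lambda>x. c * (norm (x - a))\<^sup>2) has_derivative
      blinfun_apply ((2 * c) *\<^sub>R blinfun_inner_left (x - a))) (at x)"
    by (simp add: power2_norm_eq_inner)
  have "((\<lambda>x. x - a) has_derivative (\<lambda>v. v)) (at x)"
    by (auto intro!: derivative_eq_intros)
  from bounded_linear.has_derivative[OF bl this]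
  have "((\<lambda>x. (2 * c) *\<^sub>R (blinfun_inner_left (x - a) :: 'a \<Rightarrow>\<^sub>L real)) has_derivative
      (\<lambda>v. (2 * c) *\<^sub>R blinfun_inner_left v)) (at x)"
    by (rule has_derivative_scaleR_right)
  then show "((\<lambda>x. (2 * c) *\<^sub>R (blinfun_inner_left (x - a) :: 'a \<Rightarrow>\<^sub>L real)) has_derivative
      blinfun_apply ((2 * c) *\<^sub>R Blinfun blinfun_inner_left)) (at x)"
    by (rule has_derivative_eq_rhs)
      (simp add: fun_eq_iff blinfun.scaleR_left bounded_linear_Blinfun_apply[OF bl])
qed simp

text \<open>Subtract \<open>\<epsilon> * (norm (x - a))\<^sup>2\<close>: it has Laplacian
  \<open>4 * \<epsilon>\<close>, vanishes at the centre and is \<open>\<epsilon> * r\<^sup>2\<close>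
  on the circle. The gain is what makes later contradictions strict.\<close>

lemma mean_value_le:
  fixes f :: "complex \<Rightarrow> real"
  assumes j: "jet2 V f f' f''"
    and lap: "\<And>x. x \<in> V \<Longrightarrow> f'' x 1 1 + f'' x \<i> \<i> \<ge> 4 * \<epsilon>"
    and r: "0 < r" "cball a r \<subseteq> V"
  shows "f a + \<epsilon> * r\<^sup>2 \<le> integral {0..2*pi} (\<lambda>t. f (a + of_real r * cis t)) / (2*pi)"
proof -
  have bl: "bounded_linear (blinfun_inner_left :: complex \<Rightarrow> complex \<Rightarrow>\<^sub>L real)"
    by (rule bounded_linear_blinfun_inner_left)
  have "f a + (- \<epsilon>) * (norm (a - a))\<^sup>2 \<le> integral {0..2*pi}
      (\<lambda>t. f (a + of_real r * cis t) + (- \<epsilon>) * (norm (a + of_real r * cis t - a))\<^sup>2) / (2*pi)"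
  proof (rule mean_value_le_of_laplacian_nonneg[OF jet2_add[OF j jet2_dist_square] _ r], unfold laplacian_rotate)
    fix x e assume "x \<in> V"
    from lap[OF this] show "0 \<le> (cmod e)\<^sup>2 *
          (blinfun_apply ((f'' x + (2 * - \<epsilon>) *\<^sub>R Blinfun blinfun_inner_left) 1) 1 +
           blinfun_apply ((f'' x + (2 * - \<epsilon>) *\<^sub>R Blinfun blinfun_inner_left) \<i>) \<i>)"
      by (intro mult_nonneg_nonneg) (auto simp: blinfun.bilinear_simps
        bounded_linear_Blinfun_apply[OF bl] blinfun_inner_left.rep_eq)
  qed
  moreover have "continuous_on {0..2*pi} (\<lambda>t. f (a + of_real r * cis t))"
    using r by (intro continuous_on_compose2[OF jet2_cont0[OF j]] continuous_intros)
      (auto simp: dist_norm norm_mult subset_iff)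
  then have "integral {0..2*pi} (\<lambda>t. f (a + of_real r * cis t) - \<epsilon> * r\<^sup>2) =
      integral {0..2*pi} (\<lambda>t. f (a + of_real r * cis t)) - 2 * pi * (\<epsilon> * r\<^sup>2)"
    by (subst integral_diff) (auto intro: integrable_continuous_real)
  ultimately show ?thesis
    using r by (simp add: norm_mult field_simps)
qed

lemma jet2_subharmonic_on:
  assumes j: "jet2 V f f' f''" and lap: "\<And>x. x \<in> V \<Longrightarrow> f'' x 1 1 + f'' x \<i> \<i> \<ge> 0"
  shows "subharmonic_on V f"
proof -
  have "openin (top_of_set V) {x \<in> V. f x < c}" for c
    using continuous_openin_preimage_gen[OF jet2_cont0[OF j], of "{..<c}"]
    by (simp add: vimage_def Int_def)
  moreover have "(\<lambda>t. f (a + of_real r * cis t)) absolutely_integrable_on {0..2*pi}"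
    if "0 < r" "cball a r \<subseteq> V" for a r
    using that by (intro absolutely_integrable_continuous_real
        continuous_on_compose2[OF jet2_cont0[OF j]] continuous_intros)
      (auto simp: dist_norm norm_mult subset_iff)
  ultimately show ?thesis
    using mean_value_le[OF j, of 0] lap
    by (auto simp: subharmonic_on_def upper_semicontinuous_on_def)
qed

text \<open>A small multiple of |y|^2 makes the Laplacian strictly positive, and then an interior
  maximum contradicts the mean value inequality with gain.\<close>

lemma maximum_principle:
  fixes f :: "complex \<Rightarrow> real"
  assumes K: "compact K" and cont: "continuous_on K f"
    and j: "jet2 (interior K) f f' f''"
    and lap: "\<And>x. x \<in> interior K \<Longrightarrow> f'' x 1 1 + f'' x \<i> \<i> \<ge> 0"
    and bd: "\<And>x. x \<in> frontier K \<Longrightarrow> f x \<le> B" and x: "x \<in> K"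
  shows "f x \<le> B"
proof (rule ccontr)
  assume "\<not> f x \<le> B"
  then have gt: "f x > B" by simp
  obtain R where R: "\<And>y. y \<in> K \<Longrightarrow> norm y \<le> R"
    using compact_imp_bounded[OF K] by (auto simp: bounded_iff)
  \<comment> \<open>Small enough that the perturbation, at most \<open>e * R\<^sup>2\<close> on
    \<open>K\<close>, cannot lift frontier values above \<open>f x\<close>; the summand 1 covers
    \<open>R = 0\<close>.\<close>
  define e where "e = (f x - B) / (2 * (R\<^sup>2 + 1))"
  have pos: "0 < R\<^sup>2 + 1" by (smt (verit) zero_le_power2)
  have e: "e > 0" using gt pos by (simp add: e_def)
  have eR: "e * R\<^sup>2 < f x - B"
  proof -
    have "e * (2 * (R\<^sup>2 + 1)) = f x - B" using pos by (simp add: e_def del: mult_numeral_1)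
    moreover have "e * (2 * (R\<^sup>2 + 1)) = 2 * e + 2 * (e * R\<^sup>2)" by (simp add: algebra_simps)
    moreover have "e * R\<^sup>2 \<ge> 0" using e by simp
    ultimately show ?thesis using e by linarith
  qed
  define h where "h y = f y + e * (norm (y - 0))\<^sup>2" for y
  have "continuous_on K h" unfolding h_def by (intro continuous_intros cont)
  then obtain y where y: "y \<in> K" "\<And>z. z \<in> K \<Longrightarrow> h z \<le> h y"
    using continuous_attains_sup[OF K] x by blast
  have "y \<notin> frontier K"
  proof
    assume "y \<in> frontier K"
    then have "h y \<le> B + e * R\<^sup>2"
      using bd R[OF y(1)] e by (auto simp: h_def intro!: add_mono power_mono)
    moreover have "f x \<le> h x" using e by (simp add: h_def)
    ultimately show False using eR y(2)[OF x] by linarith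
  qed
  then have yi: "y \<in> interior K"
    using y(1) by (simp add: frontier_def closure_closed[OF compact_imp_closed[OF K]])
  then obtain r where r: "r > 0" "cball y r \<subseteq> interior K"
    using open_contains_cball[of "interior K"] by auto
  have bl: "bounded_linear (blinfun_inner_left :: complex \<Rightarrow> complex \<Rightarrow>\<^sub>L real)"
    by (rule bounded_linear_blinfun_inner_left)
  have jh: "jet2 (interior K) h (\<lambda>x. f' x + (2 * e) *\<^sub>R blinfun_inner_left (x - 0))
      (\<lambda>x. f'' x + (2 * e) *\<^sub>R Blinfun blinfun_inner_left)"
    unfolding h_def by (rule jet2_add[OF j jet2_dist_square])
  have "h y + e * r\<^sup>2 \<le> integral {0..2*pi} (\<lambda>t. h (y + of_real r * cis t)) / (2*pi)"
  proof (rule mean_value_le[OF jh _ r])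
    fix z assume "z \<in> interior K"
    from lap[OF this]
    show "4 * e \<le> blinfun_apply ((f'' z + (2 * e) *\<^sub>R Blinfun blinfun_inner_left) 1) 1 +
         blinfun_apply ((f'' z + (2 * e) *\<^sub>R Blinfun blinfun_inner_left) \<i>) \<i>"
      by (simp add: blinfun.bilinear_simps
        bounded_linear_Blinfun_apply[OF bl] blinfun_inner_left.rep_eq)
  qed
  moreover have "integral {0..2*pi} (\<lambda>t. h (y + of_real r * cis t)) \<le> integral {0..2*pi} (\<lambda>t. h y)"
  proof (rule integral_le)
    have in_K: "y + of_real r * cis t \<in> interior K" for t
      using r by (intro subsetD[OF r(2)]) (auto simp: dist_norm norm_mult)
    show "(\<lambda>t. h (y + of_real r * cis t)) integrable_on {0..2*pi}"
      using in_K by (intro integrable_continuous_real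
        continuous_on_compose2[OF jet2_cont0[OF jh]] continuous_intros) auto
    show "h (y + of_real r * cis t) \<le> h y" for t
      using y(2)[of "y + of_real r * cis t"] in_K interior_subset by auto
  qed (rule integrable_const_ivl)
  then have "integral {0..2*pi} (\<lambda>t. h (y + of_real r * cis t)) / (2*pi) \<le> h y"
    by (simp add: divide_le_eq mult.commute)
  moreover have "e * r\<^sup>2 > 0" using e r by simp
  ultimately show False by linarith
qed

section \<open>The Levi form\<close>

text \<open>The Laplacian of the restriction to the complex line in direction \<open>b\<close>, that is, four times
  the usual Levi form.\<close>

definition levi :: "((complex ^ 'n::finite) \<Rightarrow>\<^sub>L ((complex ^ 'n) \<Rightarrow>\<^sub>L real)) \<Rightarrow> complex ^ 'n \<Rightarrow> real" where
  "levi B b = B b b + B (\<i> *s b) (\<i> *s b)"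

text \<open>\<open>hol\<close> is the Cauchy-Riemann condition for the curve and its derivative. The
  second half of it cancels the terms of the chain rule that contain \<open>u'\<close>, leaving only
  the Levi form in the direction of the tangent.\<close>

lemma laplacian_compose_holomorphic:
  fixes u :: "(complex ^ 'n::finite) \<Rightarrow> real" and \<gamma> :: "complex \<Rightarrow> complex ^ 'n"
  assumes u: "jet2 \<Omega> u u' u''" and g: "jet2 V \<gamma> g' g''" and sub: "\<gamma> ` V \<subseteq> \<Omega>"
    and hol: "\<And>\<xi>. \<xi> \<in> V \<Longrightarrow> g' \<xi> \<i> = \<i> *s g' \<xi> 1"
      "\<And>\<xi>. \<xi> \<in> V \<Longrightarrow> g'' \<xi> \<i> \<i> = - g'' \<xi> 1 1"
  obtains f' f'' where "jet2 V (\<lambda>\<xi>. u (\<gamma> \<xi>)) f' f''"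
    "\<And>\<xi>. \<xi> \<in> V \<Longrightarrow> f'' \<xi> 1 1 + f'' \<xi> \<i> \<i> = levi (u'' (\<gamma> \<xi>)) (g' \<xi> 1)"
  by (rule that[OF jet2_compose[OF g u sub]])
    (simp add: hol levi_def blinfun.bilinear_simps)

lemma bounded_linear_vector_smult:
  "bounded_linear (\<lambda>\<xi>. \<xi> *s (b :: (complex ^ 'n::finite)))"
  by (intro linear_conv_bounded_linear[THEN iffD1] linearI) (auto simp: vec_eq_iff algebra_simps)

lemma jet2_complex_line:
  fixes u :: "(complex ^ 'n::finite) \<Rightarrow> real"
  assumes u: "jet2 \<Omega> u u' u''"
  obtains f' f'' where "jet2 {\<xi>. a + \<xi> *s b \<in> \<Omega>} (\<lambda>\<xi>. u (a + \<xi> *s b)) f' f''"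
    "\<And>\<xi>. a + \<xi> *s b \<in> \<Omega> \<Longrightarrow> f'' \<xi> 1 1 + f'' \<xi> \<i> \<i> = levi (u'' (a + \<xi> *s b)) b"
proof -
  note bl = bounded_linear_vector_smult[of b]
  have app: "Blinfun (\<lambda>\<xi>. \<xi> *s b) \<xi> = \<xi> *s b" for \<xi>
    by (simp add: bounded_linear_Blinfun_apply[OF bl])
  show ?thesis
  proof (rule laplacian_compose_holomorphic[OF u, where V = "{\<xi>. a + \<xi> *s b \<in> \<Omega>}"])
    show "jet2 {\<xi>. a + \<xi> *s b \<in> \<Omega>} (\<lambda>\<xi>. a + \<xi> *s b)
        (\<lambda>\<xi>. 0 + Blinfun (\<lambda>\<xi>. \<xi> *s b)) (\<lambda>\<xi>. 0 + 0)"
      by (rule jet2_add[OF jet2_const jet2_bounded_linear[OF bl]])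
  qed (use that in \<open>auto simp: app\<close>)
qed

lemma plurisubharmonic_on_jet2I:
  fixes u :: "(complex ^ 'n::finite) \<Rightarrow> real"
  assumes u: "jet2 \<Omega> u u' u''" and levi: "\<And>p b. p \<in> \<Omega> \<Longrightarrow> levi (u'' p) b \<ge> 0"
  shows "plurisubharmonic_on \<Omega> u"
proof -
  have "openin (top_of_set \<Omega>) {x \<in> \<Omega>. u x < c}" for c
    using continuous_openin_preimage_gen[OF jet2_cont0[OF u], of "{..<c}"]
    by (simp add: vimage_def Int_def)
  moreover have "subharmonic_on {\<xi>. a + \<xi> *s b \<in> \<Omega>} (\<lambda>\<xi>. u (a + \<xi> *s b))" for a b
    by (rule jet2_complex_line[OF u, of a b], rule jet2_subharmonic_on) (auto simp: levi)
  ultimately show ?thesis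
    by (auto simp: plurisubharmonic_on_def upper_semicontinuous_on_def)
qed

text \<open>Plurisubharmonicity is defined through complex lines only; the Levi form is the way to
  carry it over to the curved \<open>worm_curve\<close>. If it were negative at \<open>p\<close>, it
  would stay negative on a small disc, where \<open>mean_value_le\<close> for \<open>- u\<close>
  contradicts the mean value inequality of \<open>u\<close>.\<close>

lemma plurisubharmonic_on_imp_levi_nonneg:
  fixes u :: "(complex ^ 'n::finite) \<Rightarrow> real"
  assumes u: "jet2 \<Omega> u u' u''" and psh: "plurisubharmonic_on \<Omega> u" and op: "open \<Omega>"
    and p: "p \<in> \<Omega>"
  shows "levi (u'' p) b \<ge> 0"
proof (rule ccontr)
  let ?V = "{\<xi>. p + \<xi> *s b \<in> \<Omega>}"
  let ?f = "\<lambda>\<xi>. u (p + \<xi> *s b)"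
  assume neg: "\<not> ?thesis"
  obtain f' f'' where f: "jet2 ?V ?f f' f''"
    and lap: "\<And>\<xi>. \<xi> \<in> ?V \<Longrightarrow> f'' \<xi> 1 1 + f'' \<xi> \<i> \<i> = levi (u'' (p + \<xi> *s b)) b"
    using jet2_complex_line[OF u, of p b] by auto
  have V0: "0 \<in> ?V" using p by simp
  have "continuous_on UNIV (\<lambda>\<xi>. p + \<xi> *s b)"
    by (intro continuous_intros bounded_linear.continuous_on[OF bounded_linear_vector_smult])
  from continuous_open_preimage[OF this open_UNIV op] have opV: "open ?V"
    by (simp add: vimage_def)
  define L where "L \<xi> = f'' \<xi> 1 1 + f'' \<xi> \<i> \<i>" for \<xi>
  \<comment> \<open>Thus \<open>L 0 = - 8 * \<epsilon>\<close>, which leaves room for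
    \<open>L < - 4 * \<epsilon>\<close> near 0, the constant in
    \<open>mean_value_le\<close>.\<close>
  define \<epsilon> where "\<epsilon> = - L 0 / 8"
  have e: "\<epsilon> > 0" using neg lap[OF V0] by (simp add: \<epsilon>_def L_def)
  have "continuous_on ?V L"
    unfolding L_def by (intro continuous_intros jet2_cont2[OF f])
  from continuous_open_preimage[OF this opV open_lessThan[of "- 4 * \<epsilon>"]]
  have opW: "open (?V \<inter> L -` {..<- 4 * \<epsilon>})" .
  have "0 \<in> ?V \<inter> L -` {..<- 4 * \<epsilon>}"
    using V0 e by (simp add: \<epsilon>_def)
  with opW obtain r where r: "r > 0" "cball 0 r \<subseteq> ?V \<inter> L -` {..<- 4 * \<epsilon>}"
    using open_contains_cball by blast
  have "jet2 (?V \<inter> L -` {..<- 4 * \<epsilon>}) (\<lambda>\<xi>. - 1 * ?f \<xi>) (\<lambda>\<xi>. - 1 *\<^sub>R f' \<xi>) (\<lambda>\<xi>. - 1 *\<^sub>R f'' \<xi>)"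
    by (rule jet2_cmult[OF jet2_subset[OF f]]) auto
  from mean_value_le[OF this, of \<epsilon> r 0] r
  have "- ?f 0 + \<epsilon> * r\<^sup>2 \<le> - (integral {0..2*pi} (\<lambda>t. ?f (0 + of_real r * cis t)) / (2*pi))"
    by (force simp: L_def blinfun.minus_left)
  moreover have "subharmonic_on ?V ?f"
    using psh p by (auto simp: plurisubharmonic_on_def)
  then have "?f 0 \<le> integral {0..2*pi} (\<lambda>t. ?f (0 + of_real r * cis t)) / (2*pi)"
    using r unfolding subharmonic_on_def by blast
  moreover have "\<epsilon> * r\<^sup>2 > 0" using e r by simp
  ultimately show False by linarith
qed

section \<open>Worm domains\<close>

lemma worm_profileD:
  assumes "worm_profile \<beta> \<eta>"
  shows worm_profile_nonneg: "\<eta> x \<ge> 0"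
    and worm_profile_zero_iff: "\<eta> x = 0 \<longleftrightarrow> \<bar>x\<bar> \<le> \<beta> - pi / 2"
    and worm_profile_deriv: "(\<eta> has_real_derivative deriv \<eta> x) (at x)"
    and worm_profile_deriv2: "(deriv \<eta> has_real_derivative deriv (deriv \<eta>) x) (at x)"
    and worm_profile_cont2: "continuous_on S (deriv (deriv \<eta>))"
proof -
  from assms have d: "\<And>k. (deriv ^^ k) \<eta> differentiable_on UNIV"
    and v: "\<eta> -` {0} = {- \<beta> + pi / 2 .. \<beta> - pi / 2}" and n: "\<And>x. 0 \<le> \<eta> x"
    by (auto simp: worm_profile_def)
  show "\<eta> x \<ge> 0" by (rule n)
  have "\<eta> x = 0 \<longleftrightarrow> x \<in> \<eta> -` {0}" by simp
  also have "\<dots> \<longleftrightarrow> \<bar>x\<bar> \<le> \<beta> - pi / 2" unfolding v by auto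
  finally show "\<eta> x = 0 \<longleftrightarrow> \<bar>x\<bar> \<le> \<beta> - pi / 2" .
  show "(\<eta> has_real_derivative deriv \<eta> x) (at x)"
    using d[of 0] by (auto simp: differentiable_on_def DERIV_deriv_iff_real_differentiable)
  show "(deriv \<eta> has_real_derivative deriv (deriv \<eta>) x) (at x)"
    using d[of 1] by (auto simp: differentiable_on_def DERIV_deriv_iff_real_differentiable)
  have "(deriv ^^ 2) \<eta> = deriv (deriv \<eta>)" by (simp add: numeral_2_eq_2)
  with d[of 2] have "continuous_on UNIV (deriv (deriv \<eta>))"
    by (metis differentiable_imp_continuous_on)
  then show "continuous_on S (deriv (deriv \<eta>))"
    using continuous_on_subset by blast
qed

lemma worm_domain_subset:
  assumes "worm_profile \<beta> \<eta>"
  obtains a where "a > 0" "worm_domain \<eta> \<subseteq> {p. cmod (p $ 1) \<le> 2 \<and> exp (- a) \<le> (cmod (p $ 2))\<^sup>2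
      \<and> (cmod (p $ 2))\<^sup>2 \<le> exp a}"
proof -
  from assms obtain a where a: "a > 0" "\<And>x. x < - a \<or> x > a \<Longrightarrow> \<eta> x > 1"
    unfolding worm_profile_def by blast
  have "cmod (p $ 1) \<le> 2 \<and> exp (- a) \<le> (cmod (p $ 2))\<^sup>2 \<and> (cmod (p $ 2))\<^sup>2 \<le> exp a"
    if p: "p \<in> worm_domain \<eta>" for p
  proof -
    let ?s = "ln ((cmod (p $ 2))\<^sup>2)"
    from p have w: "p $ 2 \<noteq> 0" and lt: "(cmod (p $ 1 - exp (\<i> * of_real ?s)))\<^sup>2 < 1 - \<eta> ?s"
      by (auto simp: worm_domain_def)
    have "\<eta> ?s < 1" using lt by (smt (verit) zero_le_power2)
    then have s: "- a \<le> ?s" "?s \<le> a" using a(2)[of ?s] by linarith+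
    have "exp ?s = (cmod (p $ 2))\<^sup>2" using w by simp
    moreover have "exp (- a) \<le> exp ?s" "exp ?s \<le> exp a" using s by simp_all
    moreover have "(cmod (p $ 1 - exp (\<i> * of_real ?s)))\<^sup>2 < 1\<^sup>2"
      using lt worm_profile_nonneg[OF assms, of ?s] by simp
    then have "cmod (p $ 1 - exp (\<i> * of_real ?s)) < 1"
      by (rule power_less_imp_less_base) simp
    then have "cmod (p $ 1) \<le> 2"
      using norm_triangle_sub[of "p $ 1" "exp (\<i> * of_real ?s)"] by simp
    ultimately show ?thesis by simp
  qed
  with a(1) that show ?thesis by blast
qed

text \<open>The lower bound for |w| persists on the closure, so that log |w|^2 is smooth in a
  neighbourhood of it; compactness bounds the gradient of a defining function.\<close>

lemma closure_worm_domain: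
  assumes "worm_profile \<beta> \<eta>"
  obtains a where "a > 0" "closure (worm_domain \<eta>) \<subseteq> {p. exp (- a) \<le> (cmod (p $ 2))\<^sup>2
      \<and> (cmod (p $ 2))\<^sup>2 \<le> exp a}" "compact (closure (worm_domain \<eta>))"
proof -
  obtain a where a: "a > 0" "worm_domain \<eta> \<subseteq> {p. cmod (p $ 1) \<le> 2 \<and> exp (- a) \<le> (cmod (p $ 2))\<^sup>2
      \<and> (cmod (p $ 2))\<^sup>2 \<le> exp a}" (is "_ \<subseteq> ?B")
    using worm_domain_subset[OF assms] by blast
  have "closed {p :: complex ^ 2. exp (- a) \<le> (cmod (p $ 2))\<^sup>2 \<and> (cmod (p $ 2))\<^sup>2 \<le> exp a}"
    by (intro closed_Collect_conj closed_Collect_le continuous_intros)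
  then have "closure (worm_domain \<eta>) \<subseteq> {p. exp (- a) \<le> (cmod (p $ 2))\<^sup>2
      \<and> (cmod (p $ 2))\<^sup>2 \<le> exp a}"
    using a(2) by (intro closure_minimal) auto
  moreover have "bounded ?B"
  proof (rule boundedI)
    fix p assume p: "p \<in> ?B"
    have "norm p \<le> (\<Sum>i\<in>UNIV. norm (p $ i))"
      unfolding norm_vec_def by (rule L2_set_le_sum) simp
    also have "\<dots> = norm (p $ 1) + norm (p $ 2)" by (simp add: sum_2)
    also have "cmod (p $ 2) \<le> exp a"
    proof (rule ccontr)
      assume n: "\<not> cmod (p $ 2) \<le> exp a"
      moreover have "1 < exp a" using a(1) by simp
      ultimately have "exp a < cmod (p $ 2)" "1 < cmod (p $ 2)" by linarith+
      then have "exp a * 1 < cmod (p $ 2) * cmod (p $ 2)"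
        by (intro mult_strict_mono) auto
      with p show False by (simp add: power2_eq_square)
    qed
    finally show "norm p \<le> 2 + exp a" using p by simp
  qed
  then have "compact (closure (worm_domain \<eta>))"
    using a(2) bounded_subset by (auto simp: compact_closure)
  ultimately show ?thesis using that a(1) by blast
qed

lemma open_worm_domain:
  assumes "worm_profile \<beta> \<eta>"
  shows "open (worm_domain \<eta>)"
proof -
  let ?U = "{p :: complex ^ 2. p $ 2 \<noteq> 0}"
  let ?F = "\<lambda>p :: complex ^ 2. 1 - \<eta> (ln ((cmod (p $ 2))\<^sup>2)) -
         (cmod (p $ 1 - exp (\<i> * of_real (ln ((cmod (p $ 2))\<^sup>2)))))\<^sup>2"
  have U: "open ?U" by (intro open_Collect_neq continuous_intros)
  have e: "continuous_on UNIV \<eta>"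
    by (rule DERIV_continuous_on[OF has_field_derivative_at_within[OF worm_profile_deriv[OF assms]]])
  have "continuous_on ?U ?F"
    by (intro continuous_intros continuous_on_compose2[OF e]) auto
  from continuous_open_preimage[OF this U open_greaterThan[of 0]]
  have "open (?U \<inter> ?F -` {0<..})" .
  also have "?U \<inter> ?F -` {0<..} = worm_domain \<eta>" by (auto simp: worm_domain_def)
  finally show ?thesis .
qed

section \<open>Exponential curves and harmonic exponentials\<close>

lemma jet2_cexp:
  "jet2 U (\<lambda>\<xi>::complex. exp (c * \<xi>)) (\<lambda>\<xi>. blinfun_mult_right (c * exp (c * \<xi>)))
     (\<lambda>\<xi>. Blinfun blinfun_mult_right o\<^sub>L blinfun_mult_right (c * c * exp (c * \<xi>)))"
  unfolding jet2_def
proof (intro conjI ballI)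
  have bl: "bounded_linear (blinfun_mult_right :: complex \<Rightarrow> complex \<Rightarrow>\<^sub>L complex)"
    by (rule bounded_linear_blinfun_mult_right)
  fix \<xi> :: complex
  have d: "((\<lambda>\<xi>. exp (c * \<xi>)) has_field_derivative c * exp (c * \<xi>)) (at \<xi>)"
    by (auto intro!: derivative_eq_intros)
  then show "((\<lambda>\<xi>. exp (c * \<xi>)) has_derivative blinfun_apply (blinfun_mult_right (c * exp (c * \<xi>)))) (at \<xi>)"
    by (simp add: has_field_derivative_def blinfun_mult_right.rep_eq)
  have "((\<lambda>\<xi>. c * exp (c * \<xi>)) has_derivative (\<lambda>h. c * c * exp (c * \<xi>) * h)) (at \<xi>)"
    using DERIV_cmult[OF d, of c] unfolding has_field_derivative_def
    by (simp only: mult.assoc[symmetric])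
  from bounded_linear.has_derivative[OF bl this]
  show "((\<lambda>\<xi>. blinfun_mult_right (c * exp (c * \<xi>))) has_derivative
     blinfun_apply (Blinfun blinfun_mult_right o\<^sub>L blinfun_mult_right (c * c * exp (c * \<xi>)))) (at \<xi>)"
    by (rule has_derivative_eq_rhs)
      (simp add: fun_eq_iff bounded_linear_Blinfun_apply[OF bl] blinfun_mult_right.rep_eq)
qed (intro continuous_intros bounded_linear.continuous_on[OF bounded_linear_blinfun_mult_right])

lemma jet2_exponential_curve:
  fixes v :: "complex ^ 'n::finite"
  obtains g' g'' where "jet2 U (\<lambda>\<xi>. exp (c * \<xi>) *s v) g' g''"
    "\<And>\<xi>. g' \<xi> \<i> = \<i> *s g' \<xi> 1" "\<And>\<xi>. g'' \<xi> \<i> \<i> = - g'' \<xi> 1 1"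
proof -
  note bl = bounded_linear_vector_smult[of v]
  have ii: "x * \<i> * \<i> = - x" for x by (simp add: mult.assoc)
  have blm: "bounded_linear (blinfun_mult_right :: complex \<Rightarrow> complex \<Rightarrow>\<^sub>L complex)"
    by (rule bounded_linear_blinfun_mult_right)
  show ?thesis
    by (rule that[OF jet2_compose[OF jet2_cexp jet2_bounded_linear[OF bl] subset_UNIV]])
      (simp_all add: bounded_linear_Blinfun_apply[OF bl] bounded_linear_Blinfun_apply[OF blm]
        blinfun_mult_right.rep_eq blinfun.bilinear_simps vec_eq_iff ii)
qed

lemma jet2_harmonic_exp:
  obtains h' h'' where "jet2 U (\<lambda>\<xi>. Re (exp (c * \<xi>))) h' h''"
    "\<And>\<xi>. h'' \<xi> 1 1 + h'' \<xi> \<i> \<i> = (0::real)"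
proof -
  have ii: "x * \<i> * \<i> = - x" for x by (simp add: mult.assoc)
  have blm: "bounded_linear (blinfun_mult_right :: complex \<Rightarrow> complex \<Rightarrow>\<^sub>L complex)"
    by (rule bounded_linear_blinfun_mult_right)
  show ?thesis
    by (rule that[OF jet2_compose[OF jet2_cexp jet2_bounded_linear[OF bounded_linear_Re] subset_UNIV]])
      (simp_all add: bounded_linear_Blinfun_apply[OF bounded_linear_Re] bounded_linear_Blinfun_apply[OF blm]
        blinfun_mult_right.rep_eq blinfun.bilinear_simps ii)
qed

section \<open>The upper bound\<close>

lemma jet2_neg_powr:
  fixes \<rho> :: "'a::real_normed_vector \<Rightarrow> real"
  assumes "jet2 \<Omega> \<rho> r' r''" "\<And>p. p \<in> \<Omega> \<Longrightarrow> \<rho> p < 0"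
  obtains u' u'' where "jet2 \<Omega> (\<lambda>p. - ((- \<rho> p) powr \<tau>)) u' u''"
proof -
  have j: "jet2 {..<0} (\<lambda>t::real. - ((- t) powr \<tau>))
      (\<lambda>t. blinfun_scaleR_left (\<tau> * (- t) powr (\<tau> - 1)))
      (\<lambda>t. blinfun_scaleR_left (blinfun_scaleR_left (- (\<tau> * (\<tau> - 1) * (- t) powr (\<tau> - 1 - 1)))))"
    by (rule jet2_real) (auto intro!: derivative_eq_intros continuous_intros)
  from assms(2) have "\<rho> ` \<Omega> \<subseteq> {..<0}" by auto
  from that[OF jet2_compose[OF assms(1) j this]] show ?thesis .
qed

text \<open>Along this curve \<open>log |w|\<^sup>2 = (1 - \<kappa>) \<theta>\<close> with \<open>\<theta> = arg z\<close>, so the angle between \<open>z\<close> and the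
  disc centre is only \<open>\<kappa> \<theta>\<close>, and the curve stays in the worm for \<open>|\<theta>|\<close> almost up to \<open>\<beta>\<close>.\<close>

definition worm_curve :: "real \<Rightarrow> complex \<Rightarrow> complex ^ 2" where
  "worm_curve \<kappa> \<xi> = exp (1 * \<xi>) *s axis 1 1 + exp (- \<i> * of_real ((1 - \<kappa>) / 2) * \<xi>) *s axis 2 1"

lemma worm_curve_nth:
  "worm_curve \<kappa> \<xi> $ 1 = exp \<xi>" "worm_curve \<kappa> \<xi> $ 2 = exp (- \<i> * of_real ((1 - \<kappa>) / 2) * \<xi>)"
  by (simp_all add: worm_curve_def axis_def)

lemma ln_worm_curve: "ln ((cmod (worm_curve \<kappa> \<xi> $ 2))\<^sup>2) = (1 - \<kappa>) * Im \<xi>"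
  by (simp add: worm_curve_nth ln_realpow)

lemma jet2_worm_curve:
  obtains g' g'' where "jet2 U (worm_curve \<kappa>) g' g''"
    "\<And>\<xi>. g' \<xi> \<i> = \<i> *s g' \<xi> 1" "\<And>\<xi>. g'' \<xi> \<i> \<i> = - g'' \<xi> 1 1"
proof -
  obtain g' g'' where g: "jet2 U (\<lambda>\<xi>. exp (1 * \<xi>) *s (axis 1 1 :: complex ^ 2)) g' g''"
    "\<And>\<xi>. g' \<xi> \<i> = \<i> *s g' \<xi> 1" "\<And>\<xi>. g'' \<xi> \<i> \<i> = - g'' \<xi> 1 1"
    using jet2_exponential_curve by blast
  obtain h' h'' where h: "jet2 U (\<lambda>\<xi>. exp (- \<i> * of_real ((1 - \<kappa>) / 2) * \<xi>) *s (axis 2 1 :: complex ^ 2)) h' h''"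
    "\<And>\<xi>. h' \<xi> \<i> = \<i> *s h' \<xi> 1" "\<And>\<xi>. h'' \<xi> \<i> \<i> = - h'' \<xi> 1 1"
    using jet2_exponential_curve by blast
  from jet2_add[OF g(1) h(1)] show ?thesis
    by (intro that[of "\<lambda>\<xi>. g' \<xi> + h' \<xi>" "\<lambda>\<xi>. g'' \<xi> + h'' \<xi>"])
      (simp_all add: worm_curve_def[abs_def] g h blinfun.bilinear_simps vec_eq_iff algebra_simps)
qed

text \<open>The first condition gives \<eta> = 0. By the law of cosines the unit disc about exp
  (\<i> s) is then |z| < 2 cos (arg z - s), and here the angle is
  \<open>\<kappa> * Im \<xi>\<close>.\<close>

lemma worm_curve_mem:
  assumes eta: "worm_profile \<beta> \<eta>"
    and "\<bar>(1 - \<kappa>) * Im \<xi>\<bar> \<le> \<beta> - pi / 2" and "exp (Re \<xi>) < 2 * cos (\<kappa> * Im \<xi>)"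
  shows "worm_curve \<kappa> \<xi> \<in> worm_domain \<eta>"
proof -
  let ?s = "(1 - \<kappa>) * Im \<xi>"
  have "\<eta> ?s = 0" using worm_profile_zero_iff[OF eta] assms(2) by simp
  moreover have "(cmod (exp \<xi> - exp (\<i> * of_real ?s)))\<^sup>2
      = (exp (Re \<xi>))\<^sup>2 - 2 * exp (Re \<xi>) * cos (Im \<xi> - ?s) + 1"
  proof -
    have "(cmod (exp \<xi> - exp (\<i> * of_real ?s)))\<^sup>2 =
       (exp (Re \<xi>) * cos (Im \<xi>) - cos ?s)\<^sup>2 + (exp (Re \<xi>) * sin (Im \<xi>) - sin ?s)\<^sup>2"
      by (simp add: cmod_power2 Re_exp Im_exp)
    also have "\<dots> = (exp (Re \<xi>))\<^sup>2 * ((sin (Im \<xi>))\<^sup>2 + (cos (Im \<xi>))\<^sup>2) + ((sin ?s)\<^sup>2 + (cos ?s)\<^sup>2)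
        - 2 * exp (Re \<xi>) * (cos (Im \<xi>) * cos ?s + sin (Im \<xi>) * sin ?s)"
      by algebra
    finally show ?thesis unfolding sin_cos_squared_add cos_diff by linarith
  qed
  moreover have "Im \<xi> - ?s = \<kappa> * Im \<xi>" by (simp add: algebra_simps)
  moreover have "(exp (Re \<xi>))\<^sup>2 < exp (Re \<xi>) * (2 * cos (\<kappa> * Im \<xi>))"
    using assms(3) by (simp add: power2_eq_square)
  moreover have "worm_curve \<kappa> \<xi> $ 2 \<noteq> 0" by (simp add: worm_curve_nth)
  ultimately show ?thesis
    by (simp add: worm_domain_def ln_worm_curve worm_curve_nth(1))
qed

text \<open>For |w| = 1, that is s = 0, the segment from (0, w) to (x, w) starts at a point outside
  the domain, where \<rho> is nonnegative, and runs in the compact closure, where the gradient is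
  bounded. Real parameters of \<open>worm_curve\<close> give such w.\<close>

lemma neg_defining_function_le_linear:
  assumes eta: "worm_profile \<beta> \<eta>" and beta: "pi / 2 < \<beta>"
    and df: "defining_function (worm_domain \<eta>) \<rho>"
  obtains C where "C > 0" "\<And>x w. 0 < x \<Longrightarrow> x \<le> 1 \<Longrightarrow> cmod w = 1 \<Longrightarrow>
     - \<rho> (of_real x *s axis 1 1 + w *s axis 2 1) \<le> C * x"
proof -
  let ?\<Omega> = "worm_domain \<eta>"
  from df obtain U r' r'' where U: "open U" "closure ?\<Omega> \<subseteq> U" and j: "jet2 U \<rho> r' r''"
    and Om: "?\<Omega> = {z. \<rho> z < 0}"
    unfolding defining_function_def C2_on_iff_jet2 by blast
  have "compact (closure ?\<Omega>)" using closure_worm_domain[OF eta] by blast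
  then have "compact ((\<lambda>p. norm (r' p)) ` closure ?\<Omega>)"
    using U(2) by (intro compact_continuous_image continuous_intros
        continuous_on_subset[OF jet2_cont1[OF j]])
  then obtain C where C: "\<And>p. p \<in> closure ?\<Omega> \<Longrightarrow> norm (r' p) \<le> C"
    using compact_imp_bounded[of "(\<lambda>p. norm (r' p)) ` closure ?\<Omega>"] by (auto simp: bounded_iff)
  have eta0: "\<eta> 0 = 0" using worm_profile_zero_iff[OF eta] beta by simp
  have "- \<rho> (of_real x *s axis 1 1 + w *s axis 2 1) \<le> max C 1 * x"
    if x: "0 < x" "x \<le> 1" and w: "cmod w = 1" for x w
  proof -
    define p :: "real \<Rightarrow> complex ^ 2" where "p t = of_real t *s axis 1 1 + w *s axis 2 1" for t
    have p12: "p t $ 1 = of_real t" "p t $ 2 = w" for t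
      by (simp_all add: p_def axis_def)
    have w0: "w \<noteq> 0" using w by auto
    have p: "p t \<in> ?\<Omega> \<longleftrightarrow> \<bar>t - 1\<bar> < 1" for t
    proof -
      have "p t \<in> ?\<Omega> \<longleftrightarrow> (cmod (of_real (t - 1)))\<^sup>2 < 1"
        using w0 by (simp add: worm_domain_def p12 w eta0)
      also have "\<dots> \<longleftrightarrow> \<bar>t - 1\<bar> < 1"
        by (simp only: norm_of_real power2_abs abs_square_less_1)
      finally show ?thesis .
    qed
    have dp: "(p has_derivative (\<lambda>h. h *\<^sub>R axis 1 1)) (at t)" for t
    proof -
      have "p = (\<lambda>t. t *\<^sub>R axis 1 1 + w *s axis 2 1)"
        by (simp add: p_def fun_eq_iff vec_eq_iff) (simp add: scaleR_conv_of_real)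
      then show ?thesis by (auto intro!: derivative_eq_intros)
    qed
    have cp: "continuous_on S p" for S
      using dp by (meson continuous_at_imp_continuous_on has_derivative_continuous)
    have cl: "p t \<in> closure ?\<Omega>" if "0 \<le> t" "t \<le> 1" for t
    proof -
      have "p ` closure {0<..<1} \<subseteq> closure ?\<Omega>"
        by (rule image_closure_subset[OF cp closed_closure])
          (use p closure_subset in fastforce)
      then show ?thesis using that by auto
    qed
    have dr: "((\<lambda>t. \<rho> (p t)) has_real_derivative r' (p t) (axis 1 1)) (at t)"
      if "0 \<le> t" "t \<le> 1" for t
      unfolding has_field_derivative_def
      by (rule has_derivative_eq_rhs[OF has_derivative_compose[OF dp jet2_D1[OF j]]])
        (use cl[OF that] U(2) in \<open>auto simp: blinfun.scaleR_right mult.commute fun_eq_iff\<close>)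
    obtain z where z: "0 < z" "z < x" "\<rho> (p x) - \<rho> (p 0) = (x - 0) * r' (p z) (axis 1 1)"
      using MVT2[OF x(1) dr] x by (meson order_trans)
    have "\<rho> (p 0) \<ge> 0" using p[of 0] Om by auto
    moreover have "\<bar>r' (p z) (axis 1 1)\<bar> \<le> max C 1"
      using norm_blinfun[of "r' (p z)" "axis 1 1"] C[OF cl[of z]] z x by simp
    then have "x * - r' (p z) (axis 1 1) \<le> x * max C 1"
      using x by (intro mult_left_mono) auto
    ultimately show ?thesis
      using z(3) by (simp add: p_def[symmetric] mult.commute)
  qed
  with that[of "max C 1"] show ?thesis by simp
qed

theorem DF_exponent_worm_le:
  assumes beta: "pi / 2 < \<beta>" and eta: "worm_profile \<beta> \<eta>"
    and ex: "DF_exponent (worm_domain \<eta>) \<tau>"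
  shows "\<tau> \<le> pi / (2 * \<beta>)"
proof (rule ccontr)
  assume "\<not> ?thesis"
  then have gt: "pi / (2 * \<beta>) < \<tau>" by simp
  let ?\<Omega> = "worm_domain \<eta>"
  from ex obtain \<rho> where tau: "0 < \<tau>" "\<tau> < 1" and df: "defining_function ?\<Omega> \<rho>"
    and psh: "plurisubharmonic_on ?\<Omega> (\<lambda>z. - ((- \<rho> z) powr \<tau>))"
    by (auto simp: DF_exponent_def)
  obtain \<sigma> where sig: "pi / (2 * \<beta>) < \<sigma>" "\<sigma> < \<tau>" using dense[OF gt] by auto
  obtain \<kappa> where kap: "pi / (2 * \<beta>) < \<kappa>" "\<kappa> < \<sigma>" using dense[OF sig(1)] by auto
  have "0 < \<beta>" using beta pi_gt_zero by linarith
  then have pb: "0 < pi / (2 * \<beta>)" by simp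
  then have pos: "0 < \<kappa>" "0 < \<sigma>" using kap sig by linarith+
  have kb: "pi / (2 * \<kappa>) < \<beta>" 
    using kap(1) pos beta pi_gt_zero by (simp add: field_simps)
  from df obtain U r' r'' where U: "open U" "closure ?\<Omega> \<subseteq> U" and j: "jet2 U \<rho> r' r''"
    and Om: "?\<Omega> = {z. \<rho> z < 0}"
    unfolding defining_function_def C2_on_iff_jet2 by blast
  define u where "u = (\<lambda>z. - ((- \<rho> z) powr \<tau>))"
  have "jet2 ?\<Omega> \<rho> r' r''" using U closure_subset by (intro jet2_subset[OF j]) blast
  then obtain u' u'' where ju: "jet2 ?\<Omega> u u' u''"
    unfolding u_def by (rule jet2_neg_powr) (use Om in auto)
  have levi: "levi (u'' p) b \<ge> 0" if "p \<in> ?\<Omega>" for p b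
    using plurisubharmonic_on_imp_levi_nonneg[OF ju _ open_worm_domain[OF eta] that] psh
    by (simp add: u_def)
  \<comment> \<open>The harmonic function Re (exp (\<sigma> \<xi>)) vanishes for |Im \<xi>| =
    \<open>A\<close>. The bound exp \<open>x0\<close> is half of the least value of 2 cos (\<kappa>
    Im \<xi>) on the strip, which makes the disc condition strict.\<close>
  define A where "A = pi / (2 * \<sigma>)"
  define x0 where "x0 = ln (cos (\<kappa> * A))"
  have A: "A > 0" "\<kappa> * A < pi / 2" "\<sigma> * A = pi / 2" "\<kappa> * A > 0"
    using pos kap pi_gt_zero by (simp_all add: A_def field_simps)
  have kA: "\<kappa> * A \<le> pi" using A(2) pi_gt_zero by linarith
  have cA: "cos (\<kappa> * A) > 0" using A by (intro cos_gt_zero) auto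
  have x0: "exp x0 = cos (\<kappa> * A)" using cA by (simp add: x0_def)
  have x0_le: "x0 \<le> 0" using cA by (simp add: x0_def)
  let ?g = "worm_curve \<kappa>"
  have mem: "?g \<xi> \<in> ?\<Omega>" if "Re \<xi> \<le> x0" "\<bar>Im \<xi>\<bar> \<le> A" for \<xi>
  proof (rule worm_curve_mem[OF eta])
    have "(1 - \<kappa>) * \<bar>Im \<xi>\<bar> \<le> (1 - \<kappa>) * (pi / (2 * \<kappa>))"
    proof (rule mult_left_mono)
      have "A \<le> pi / (2 * \<kappa>)" unfolding A_def using pos kap
        by (intro divide_left_mono) auto
      then show "\<bar>Im \<xi>\<bar> \<le> pi / (2 * \<kappa>)" using that by simp
    qed (use kap sig tau in simp)
    also have "\<dots> = pi / (2 * \<kappa>) - pi / 2" using pos by (simp add: field_simps)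
    finally show "\<bar>(1 - \<kappa>) * Im \<xi>\<bar> \<le> \<beta> - pi / 2"
      using kb kap sig tau by (simp add: abs_mult)
    have "exp (Re \<xi>) \<le> cos (\<kappa> * A)" using that x0 by (metis exp_le_cancel_iff)
    also have "\<kappa> * \<bar>Im \<xi>\<bar> \<le> \<kappa> * A" using that pos by simp
    then have "cos (\<kappa> * A) \<le> cos (\<bar>\<kappa> * Im \<xi>\<bar>)"
      using kA pos by (intro cos_monotone_0_pi_le) (auto simp: abs_mult)
    finally have "exp (Re \<xi>) \<le> cos (\<kappa> * Im \<xi>)" by simp
    moreover have "exp (Re \<xi>) > 0" by simp
    ultimately show "exp (Re \<xi>) < 2 * cos (\<kappa> * Im \<xi>)" by linarith
  qed
  obtain g' g'' where g: "jet2 UNIV ?g g' g''"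
    "\<And>\<xi>. g' \<xi> \<i> = \<i> *s g' \<xi> 1" "\<And>\<xi>. g'' \<xi> \<i> \<i> = - g'' \<xi> 1 1"
    using jet2_worm_curve by blast
  define V where "V = ?g -` ?\<Omega>"
  obtain f' f'' where f: "jet2 V (\<lambda>\<xi>. u (?g \<xi>)) f' f''"
    and lapf: "\<And>\<xi>. \<xi> \<in> V \<Longrightarrow> f'' \<xi> 1 1 + f'' \<xi> \<i> \<i> = levi (u'' (?g \<xi>)) (g' \<xi> 1)"
    by (rule laplacian_compose_holomorphic[OF ju jet2_subset[OF g(1) subset_UNIV], of V])
      (auto simp: V_def g)
  define L where "L = (\<lambda>\<theta>. - u (?g (Complex x0 \<theta>)))"
  have upos: "- u p > 0" if "p \<in> ?\<Omega>" for p
    using that Om by (auto simp: u_def)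
  have "continuous_on {-A..A} L"
    unfolding L_def Complex_eq
    by (intro continuous_intros continuous_on_compose2[OF jet2_cont0[OF f]])
      (auto simp: V_def intro!: mem)
  then obtain \<theta>0 where th: "\<theta>0 \<in> {-A..A}" "\<And>\<theta>. \<theta> \<in> {-A..A} \<Longrightarrow> L \<theta>0 \<le> L \<theta>"
    using continuous_attains_inf[of "{-A..A}" L] A by auto
  define m where "m = L \<theta>0"
  have m: "m > 0" unfolding m_def L_def using th A by (intro upos mem) auto
  \<comment> \<open>Chosen so that \<open>c0 * exp (\<sigma> * x0) = m\<close>, the minimum of
    \<open>- u\<close> on the right-hand side of the half-strip.\<close>
  define c0 where "c0 = m * exp (- \<sigma> * x0)"
  have c0: "c0 > 0" using m by (simp add: c0_def)
  obtain h' h'' where h: "jet2 V (\<lambda>\<xi>. Re (exp (of_real \<sigma> * \<xi>))) h' h''"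
    and laph: "\<And>\<xi>. h'' \<xi> 1 1 + h'' \<xi> \<i> \<i> = (0::real)"
    using jet2_harmonic_exp by blast
  define F where "F \<xi> = u (?g \<xi>) + c0 * Re (exp (of_real \<sigma> * \<xi>))" for \<xi>
  have jF: "jet2 V F (\<lambda>\<xi>. f' \<xi> + c0 *\<^sub>R h' \<xi>) (\<lambda>\<xi>. f'' \<xi> + c0 *\<^sub>R h'' \<xi>)"
    unfolding F_def
    by (rule jet2_add[OF f jet2_cmult[OF h]])
  \<comment> \<open>The half-strip is unbounded, so it is cut off at Re \<xi> = -N. On the right
    side \<open>c0\<close> makes F nonpositive, on the horizontal sides the cosine is 0, and on the
    left side the harmonic term is at most the stated error, which tends to 0 with growing
    N.\<close>
  have Fle: "F (of_real x) \<le> c0 * exp (- \<sigma> * N)" if x: "- N \<le> x" "x \<le> x0" for x N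
  proof (rule maximum_principle[where K = "cbox (Complex (-N) (-A)) (Complex x0 A)"])
    let ?K = "cbox (Complex (-N) (-A)) (Complex x0 A)"
    have K: "\<xi> \<in> V" if "\<xi> \<in> ?K" for \<xi>
      using that by (auto simp: V_def in_cbox_complex_iff intro!: mem)
    show "compact ?K" by simp
    show "continuous_on ?K F"
      by (rule continuous_on_subset[OF jet2_cont0[OF jF]]) (use K in blast)
    show "jet2 (interior ?K) F (\<lambda>\<xi>. f' \<xi> + c0 *\<^sub>R h' \<xi>) (\<lambda>\<xi>. f'' \<xi> + c0 *\<^sub>R h'' \<xi>)"
      by (rule jet2_subset[OF jF]) (use K interior_subset in blast)
    show "of_real x \<in> ?K" using x A by (auto simp: in_cbox_complex_iff)
    show "0 \<le> (f'' \<xi> + c0 *\<^sub>R h'' \<xi>) 1 1 + (f'' \<xi> + c0 *\<^sub>R h'' \<xi>) \<i> \<i>"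
      if "\<xi> \<in> interior ?K" for \<xi>
    proof -
      have "\<xi> \<in> V" using K that interior_subset by blast
      then have "f'' \<xi> 1 1 + f'' \<xi> \<i> \<i> \<ge> 0" using lapf levi by (simp add: V_def)
      moreover have "c0 * h'' \<xi> 1 1 + c0 * h'' \<xi> \<i> \<i> = 0"
        using laph[of \<xi>] by (simp flip: distrib_left)
      ultimately show ?thesis by (simp add: blinfun.bilinear_simps)
    qed
    fix \<xi> assume xi: "\<xi> \<in> frontier ?K"
    then have box: "- N \<le> Re \<xi>" "Re \<xi> \<le> x0" "\<bar>Im \<xi>\<bar> \<le> A"
      and cases: "Re \<xi> = - N \<or> Re \<xi> = x0 \<or> \<bar>Im \<xi>\<bar> = A"
      by (auto simp: frontier_cbox in_cbox_complex_iff in_box_complex_iff)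
    have up: "- u (?g \<xi>) > 0" using box by (intro upos mem)
    have FF: "F \<xi> = u (?g \<xi>) + c0 * (exp (\<sigma> * Re \<xi>) * cos (\<sigma> * Im \<xi>))"
      by (simp add: F_def Re_exp)
    have nn: "0 \<le> c0 * exp (- \<sigma> * N)" using c0 by simp
    consider "Re \<xi> = - N" | "Re \<xi> = x0" | "\<bar>Im \<xi>\<bar> = A" using cases by blast
    then show "F \<xi> \<le> c0 * exp (- \<sigma> * N)"
    proof cases
      case 1
      have "exp (\<sigma> * Re \<xi>) * cos (\<sigma> * Im \<xi>) \<le> exp (\<sigma> * Re \<xi>) * 1"
        by (intro mult_left_mono) auto
      then have "c0 * (exp (\<sigma> * Re \<xi>) * cos (\<sigma> * Im \<xi>)) \<le> c0 * exp (- \<sigma> * N)"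
        using c0 1 by simp
      with up FF show ?thesis by linarith
    next
      case 2
      have "exp (\<sigma> * Re \<xi>) * cos (\<sigma> * Im \<xi>) \<le> exp (\<sigma> * x0) * 1"
        unfolding 2 by (intro mult_left_mono) auto
      then have "c0 * (exp (\<sigma> * Re \<xi>) * cos (\<sigma> * Im \<xi>)) \<le> c0 * exp (\<sigma> * x0)"
        using c0 by simp
      also have "\<dots> = m" by (simp add: c0_def exp_minus)
      also have "m \<le> - u (?g \<xi>)"
      proof -
        have "Im \<xi> \<in> {-A..A}" using box by auto
        from th(2)[OF this] show ?thesis
          using 2 by (simp add: m_def L_def) (metis complex_surj)
      qed
      finally show ?thesis using FF nn by linarith
    next
      case 3
      have "cos (\<sigma> * Im \<xi>) = cos \<bar>\<sigma> * Im \<xi>\<bar>" by simp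
      also have "\<bar>\<sigma> * Im \<xi>\<bar> = pi / 2" using 3 A pos by (simp add: abs_mult)
      finally have "cos (\<sigma> * Im \<xi>) = 0" by simp
      with FF up nn show ?thesis by simp
    qed
  qed
  have F0: "F (of_real x) \<le> 0" if x: "x \<le> x0" for x
  proof (rule ccontr)
    assume "\<not> F (of_real x) \<le> 0"
    then have pos': "F (of_real x) / c0 > 0" using c0 by simp
    \<comment> \<open>The first entry puts \<open>x\<close> into the rectangle, the second makes the
      error at most half of the supposed positive value.\<close>
    define N where "N = max (- x) (- ln (F (of_real x) / (2 * c0)) / \<sigma>)"
    have "- ln (F (of_real x) / (2 * c0)) / \<sigma> \<le> N" by (simp add: N_def)
    then have "- ln (F (of_real x) / (2 * c0)) \<le> N * \<sigma>"
      unfolding pos_divide_le_eq[OF pos(2)] .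
    then have "exp (- \<sigma> * N) \<le> exp (ln (F (of_real x) / (2 * c0)))"
      by (simp only: exp_le_cancel_iff) (simp add: mult.commute)
    also have "\<dots> = F (of_real x) / (2 * c0)"
      using pos' c0 by (intro exp_ln) (simp add: zero_less_divide_iff)
    finally have e: "exp (- \<sigma> * N) \<le> F (of_real x) / (2 * c0)" .
    have "F (of_real x) \<le> c0 * exp (- \<sigma> * N)"
      by (rule Fle) (use x in \<open>auto simp: N_def\<close>)
    also have "c0 * exp (- \<sigma> * N) \<le> c0 * (F (of_real x) / (2 * c0))"
      using c0 e by (intro mult_left_mono) auto
    also have "\<dots> = F (of_real x) / 2" using c0 by simp
    finally show False using pos' c0 by (simp add: zero_less_divide_iff)
  qed
  obtain C where C: "C > 0" "\<And>x w. 0 < x \<Longrightarrow> x \<le> 1 \<Longrightarrow> cmod w = 1 \<Longrightarrow>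
     - \<rho> (of_real x *s axis 1 1 + w *s axis 2 1) \<le> C * x"
    using neg_defining_function_le_linear[OF eta beta df] by blast
  have key: "c0 * exp (\<sigma> * x) \<le> C powr \<tau> * exp (\<tau> * x)" if x: "x \<le> x0" for x
  proof -
    have "?g (of_real x) = of_real (exp x) *s axis 1 1 +
        exp (- \<i> * of_real ((1 - \<kappa>) / 2) * of_real x) *s axis 2 1"
      by (simp add: worm_curve_def exp_of_real)
    moreover have "- \<rho> (of_real (exp x) *s axis 1 1 +
        exp (- \<i> * of_real ((1 - \<kappa>) / 2) * of_real x) *s axis 2 1) \<le> C * exp x"
      by (rule C(2)) (use x x0_le in auto)
    ultimately have "- \<rho> (?g (of_real x)) \<le> C * exp x" by simp
    moreover have "\<rho> (?g (of_real x)) < 0"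
      using mem[of "of_real x"] x A Om by auto
    ultimately have "(- \<rho> (?g (of_real x))) powr \<tau> \<le> (C * exp x) powr \<tau>"
      using tau by (intro powr_mono2) auto
    also have "\<dots> = C powr \<tau> * exp (\<tau> * x)"
      using C(1) by (simp add: powr_def ln_mult distrib_left exp_add)
    finally show ?thesis using F0[OF x] by (simp add: F_def u_def Re_exp)
  qed
  define Q where "Q = c0 / C powr \<tau>"
  have Q: "Q > 0" using c0 C by (simp add: Q_def)
  \<comment> \<open>So far to the left that \<open>(\<tau> - \<sigma>) * x \<le> ln Q - 1\<close>,
    whereas \<open>key\<close> gives \<open>ln Q \<le> (\<tau> - \<sigma>) * x\<close>.\<close>
  define x where "x = min x0 ((ln Q - 1) / (\<tau> - \<sigma>))"
  have "c0 * exp (\<sigma> * x) \<le> C powr \<tau> * exp (\<tau> * x)" by (rule key) (simp add: x_def)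
  then have "Q * exp (\<sigma> * x) \<le> exp (\<tau> * x)" using C by (simp add: Q_def field_simps)
  then have "ln (Q * exp (\<sigma> * x)) \<le> \<tau> * x"
    using Q by (metis exp_gt_zero ln_exp ln_le_cancel_iff mult_pos_pos)
  then have "ln Q \<le> (\<tau> - \<sigma>) * x" using Q by (simp add: ln_mult algebra_simps)
  also have "\<dots> \<le> (\<tau> - \<sigma>) * ((ln Q - 1) / (\<tau> - \<sigma>))"
    using sig by (intro mult_left_mono) (auto simp: x_def)
  also have "\<dots> = ln Q - 1" using sig by simp
  finally show False by simp
qed

section \<open>Calculus of Levi forms\<close>

text \<open>\<open>d\<close> is the real derivative, so its values at \<open>b\<close> and \<open>\<i> *s b\<close> are the two components of
  the gradient along the complex line in direction \<open>b\<close>.\<close>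

definition has_levi ::
  "(complex ^ 'n::finite) set \<Rightarrow> (complex ^ 'n \<Rightarrow> real) \<Rightarrow> (complex ^ 'n \<Rightarrow> complex ^ 'n \<Rightarrow> real) \<Rightarrow>
    (complex ^ 'n \<Rightarrow> complex ^ 'n \<Rightarrow> real) \<Rightarrow> bool" where
  "has_levi U f d l \<longleftrightarrow>
     (\<exists>f' f''. jet2 U f f' f'' \<and> (\<forall>p\<in>U. \<forall>b. f' p b = d p b \<and> levi (f'' p) b = l p b))"

lemma has_levi_eq_rhs:
  assumes "has_levi U f d l" "\<And>p b. p \<in> U \<Longrightarrow> d' p b = d p b" "\<And>p b. p \<in> U \<Longrightarrow> l' p b = l p b"
  shows "has_levi U f d' l'"
  using assms unfolding has_levi_def by metis

lemma has_levi_subset: "has_levi U f d l \<Longrightarrow> V \<subseteq> U \<Longrightarrow> has_levi V f d l"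
  unfolding has_levi_def using jet2_subset by blast

lemma has_levi_cong:
  assumes "has_levi U f d l" "open U" "\<And>p. p \<in> U \<Longrightarrow> g p = f p"
  shows "has_levi U g d l"
  using assms jet2_cong unfolding has_levi_def by metis

lemma has_levi_continuous_on: "has_levi U f d l \<Longrightarrow> continuous_on U f"
  unfolding has_levi_def using jet2_cont0 by blast

lemma has_levi_add:
  assumes "has_levi U f d l" "has_levi U g e m"
  shows "has_levi U (\<lambda>p. f p + g p) (\<lambda>p b. d p b + e p b) (\<lambda>p b. l p b + m p b)"
proof -
  from assms obtain f' f'' g' g'' where
    "jet2 U f f' f''" "\<forall>p\<in>U. \<forall>b. f' p b = d p b \<and> levi (f'' p) b = l p b"
    "jet2 U g g' g''" "\<forall>p\<in>U. \<forall>b. g' p b = e p b \<and> levi (g'' p) b = m p b"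
    unfolding has_levi_def by metis
  then show ?thesis
    unfolding has_levi_def
    by (intro exI[of _ "\<lambda>x. f' x + g' x"] exI[of _ "\<lambda>x. f'' x + g'' x"] conjI jet2_add)
      (auto simp: levi_def blinfun.add_left algebra_simps)
qed

lemma has_levi_cmult:
  assumes "has_levi U f d l"
  shows "has_levi U (\<lambda>p. c * f p) (\<lambda>p b. c * d p b) (\<lambda>p b. c * l p b)"
proof -
  from assms obtain f' f'' where
    "jet2 U f f' f''" "\<forall>p\<in>U. \<forall>b. f' p b = d p b \<and> levi (f'' p) b = l p b"
    unfolding has_levi_def by metis
  then show ?thesis
    unfolding has_levi_def
    by (intro exI[of _ "\<lambda>x. c *\<^sub>R f' x"] exI[of _ "\<lambda>x. c *\<^sub>R f'' x"] conjI jet2_cmult)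
      (auto simp: levi_def blinfun.scaleR_left simp flip: distrib_left)
qed

lemma has_levi_linear:
  assumes "bounded_linear f"
  shows "has_levi U f (\<lambda>p b. f b) (\<lambda>p b. 0)"
  unfolding has_levi_def
  by (intro exI conjI) (rule jet2_bounded_linear[OF assms],
      auto simp: levi_def bounded_linear_Blinfun_apply[OF assms])

lemma has_levi_compose:
  assumes f: "has_levi U f d l" and sub: "f ` U \<subseteq> T"
    and h: "\<And>t. t \<in> T \<Longrightarrow> (h has_real_derivative h1 t) (at t)"
      "\<And>t. t \<in> T \<Longrightarrow> (h1 has_real_derivative h2 t) (at t)" "continuous_on T h2"
  shows "has_levi U (\<lambda>p. h (f p)) (\<lambda>p b. h1 (f p) * d p b)
    (\<lambda>p b. h2 (f p) * ((d p b)\<^sup>2 + (d p (\<i> *s b))\<^sup>2) + h1 (f p) * l p b)"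
proof -
  from f obtain f' f'' where
    j: "jet2 U f f' f''" "\<forall>p\<in>U. \<forall>b. f' p b = d p b \<and> levi (f'' p) b = l p b"
    unfolding has_levi_def by metis
  show ?thesis
    unfolding has_levi_def
    by (intro exI conjI, rule jet2_compose[OF j(1) jet2_real[OF h] sub])
      (use j(2) in \<open>auto simp: levi_def blinfun.bilinear_simps power2_eq_square algebra_simps
        simp flip: distrib_left\<close>)
qed

text \<open>Polarisation, 2 f g = (f + g)^2 - f^2 - g^2, reduces the product to composition with the
  square.\<close>

lemma has_levi_mult:
  assumes f: "has_levi U f d l" and g: "has_levi U g e m"
  shows "has_levi U (\<lambda>p. f p * g p) (\<lambda>p b. f p * e p b + g p * d p b)
    (\<lambda>p b. f p * m p b + g p * l p b + 2 * (d p b * e p b + d p (\<i> *s b) * e p (\<i> *s b)))"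
proof -
  have sq: "has_levi U (\<lambda>p. (F p)\<^sup>2) (\<lambda>p b. 2 * F p * D p b)
    (\<lambda>p b. 2 * ((D p b)\<^sup>2 + (D p (\<i> *s b))\<^sup>2) + 2 * F p * L p b)"
    if "has_levi U F D L" for F D L
    by (rule has_levi_compose[OF that, of UNIV "\<lambda>t. t\<^sup>2" "\<lambda>t. 2 * t" "\<lambda>t. 2"])
      (auto intro!: derivative_eq_intros)
  have "(\<lambda>p. f p * g p) = (\<lambda>p. 1/2 * ((f p + g p)\<^sup>2 + (- 1) * ((f p)\<^sup>2 + (g p)\<^sup>2)))"
    by (simp add: fun_eq_iff power2_eq_square algebra_simps)
  moreover have "has_levi U (\<lambda>p. 1/2 * ((f p + g p)\<^sup>2 + (- 1) * ((f p)\<^sup>2 + (g p)\<^sup>2)))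
     (\<lambda>p b. f p * e p b + g p * d p b)
    (\<lambda>p b. f p * m p b + g p * l p b + 2 * (d p b * e p b + d p (\<i> *s b) * e p (\<i> *s b)))"
    by (rule has_levi_eq_rhs[OF has_levi_cmult[OF has_levi_add[OF sq[OF has_levi_add[OF f g]]
        has_levi_cmult[OF has_levi_add[OF sq[OF f] sq[OF g]]]]]])
      (simp_all add: power2_eq_square field_simps)
  ultimately show ?thesis by simp
qed

lemma has_levi_Re_nth: "has_levi U (\<lambda>p. Re (p $ k)) (\<lambda>p b. Re (b $ k)) (\<lambda>p b. 0)"
  and has_levi_Im_nth: "has_levi U (\<lambda>p. Im (p $ k)) (\<lambda>p b. Im (b $ k)) (\<lambda>p b. 0)"
  by (rule has_levi_linear, auto intro!: bounded_linear_intros bounded_linear_compose[OF bounded_linear_Re]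
    bounded_linear_compose[OF bounded_linear_Im])+

text \<open>Locally this is the real part of the holomorphic function 2 log w. Computing from Re w
  and Im w avoids the choice of a branch.\<close>

lemma has_levi_ln_norm_square:
  "has_levi {p :: complex ^ 'n::finite. p $ k \<noteq> 0} (\<lambda>p. ln ((cmod (p $ k))\<^sup>2))
     (\<lambda>p b. Re (2 * b $ k / p $ k)) (\<lambda>p b. 0)"
proof -
  let ?U = "{p :: complex ^ 'n::finite. p $ k \<noteq> 0}"
  let ?X = "\<lambda>p :: complex ^ 'n. Re (p $ k)" and ?Y = "\<lambda>p :: complex ^ 'n. Im (p $ k)"
  have pos: "0 < (Re z)\<^sup>2 + (Im z)\<^sup>2" if "z \<noteq> 0" for z
    using that complex_neq_0 by simp
  have N: "has_levi ?U (\<lambda>p. ?X p * ?X p + ?Y p * ?Y p)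
    (\<lambda>p b. 2 * (?X p * Re (b $ k) + ?Y p * Im (b $ k)))
    (\<lambda>p b. 4 * ((Re (b $ k))\<^sup>2 + (Im (b $ k))\<^sup>2))"
    by (rule has_levi_eq_rhs[OF has_levi_add[OF has_levi_mult has_levi_mult],
        OF has_levi_Re_nth has_levi_Re_nth has_levi_Im_nth has_levi_Im_nth])
      (auto simp: power2_eq_square)
  have "has_levi ?U (\<lambda>p. ln (?X p * ?X p + ?Y p * ?Y p))
     (\<lambda>p b. Re (2 * b $ k / p $ k)) (\<lambda>p b. 0)"
  proof (rule has_levi_eq_rhs[OF has_levi_compose[OF N, of "{0<..}" ln inverse "\<lambda>t. - (inverse t * inverse t)"]])
    show "(\<lambda>p. ?X p * ?X p + ?Y p * ?Y p) ` ?U \<subseteq> {0<..}"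
      using pos by (auto simp: power2_eq_square)
    fix p b :: "complex ^ 'n" assume p: "p \<in> ?U"
    let ?Q = "?X p * ?X p + ?Y p * ?Y p"
    have Q: "?Q \<noteq> 0" using pos[of "p $ k"] p by (auto simp: power2_eq_square)
    show "Re (2 * b $ k / p $ k) = inverse ?Q * (2 * (?X p * Re (b $ k) + ?Y p * Im (b $ k)))"
      by (simp add: Re_divide power2_eq_square field_simps)
    show "0 = - (inverse ?Q * inverse ?Q) * ((2 * (?X p * Re (b $ k) + ?Y p * Im (b $ k)))\<^sup>2 +
        (2 * (?X p * Re ((\<i> *s b) $ k) + ?Y p * Im ((\<i> *s b) $ k)))\<^sup>2) +
        inverse ?Q * (4 * ((Re (b $ k))\<^sup>2 + (Im (b $ k))\<^sup>2))"
    proof -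
      have "(2 * (?X p * Re (b $ k) + ?Y p * Im (b $ k)))\<^sup>2 +
        (2 * (?X p * Re ((\<i> *s b) $ k) + ?Y p * Im ((\<i> *s b) $ k)))\<^sup>2 =
        ?Q * (4 * ((Re (b $ k))\<^sup>2 + (Im (b $ k))\<^sup>2))"
        by (simp add: power2_eq_square algebra_simps)
      then show ?thesis using Q by simp
    qed
  qed (auto intro!: derivative_eq_intros continuous_intros simp: power2_eq_square inverse_eq_divide)
  then show ?thesis unfolding cmod_power2 by (simp add: power2_eq_square)
qed

text \<open>The tangent inequalities at two points add up to monotonicity of \<open>f'\<close>,
  while a negative \<open>f''\<close> would make \<open>f'\<close> drop just to the right of
  \<open>x\<close>.\<close>

lemma convex_on_imp_second_derivative_nonneg:
  fixes f :: "real \<Rightarrow> real"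
  assumes "convex_on UNIV f" "\<And>x. (f has_real_derivative f' x) (at x)"
    "\<And>x. (f' has_real_derivative f'' x) (at x)"
  shows "f'' x \<ge> 0"
proof (rule ccontr)
  assume "\<not> ?thesis"
  then obtain d where d: "d > 0" "\<And>h. 0 < h \<Longrightarrow> h < d \<Longrightarrow> f' (x + h) < f' x"
    using DERIV_neg_dec_right[OF assms(3), of x] by force
  have t: "f z - f y \<ge> f' y * (z - y)" for y z
    using convex_on_imp_above_tangent[OF assms(1), of y z "f' y"] assms(2) by auto
  have "f' x * (d/2) \<le> f' (x + d/2) * (d/2)"
    using t[of x "x + d/2"] t[of "x + d/2" x] by simp
  with d(1) d(2)[of "d/2"] show False by simp
qed

section \<open>The height function and its weight\<close>

definition worm_arg :: "complex ^ 2 \<Rightarrow> real" where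
  "worm_arg p = ln ((cmod (p $ 2))\<^sup>2)"

text \<open>The complex derivative of \<open>2 log w\<close>, whose real part is \<open>worm_arg\<close>.\<close>

definition worm_arg_deriv :: "complex ^ 2 \<Rightarrow> complex ^ 2 \<Rightarrow> complex" where
  "worm_arg_deriv p b = 2 * b $ 2 / p $ 2"

text \<open>This is 1 - \<eta>(s) - |z - exp (\<i> s)|^2 multiplied out, with the 1 cancelled by
  |exp (\<i> s)|^2. Real coordinates allow the sum and product rules for Levi forms to
  apply.\<close>

definition worm_height :: "(real \<Rightarrow> real) \<Rightarrow> complex ^ 2 \<Rightarrow> real" where
  "worm_height \<eta> p = 2 * (Re (p $ 1) * cos (worm_arg p) + Im (p $ 1) * sin (worm_arg p))
     - (Re (p $ 1) * Re (p $ 1) + Im (p $ 1) * Im (p $ 1)) - \<eta> (worm_arg p)"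

definition worm_height_deriv :: "(real \<Rightarrow> real) \<Rightarrow> complex ^ 2 \<Rightarrow> complex ^ 2 \<Rightarrow> real" where
  "worm_height_deriv \<eta>1 p b =
     2 * (Re (b $ 1) * cos (worm_arg p) - Re (p $ 1) * sin (worm_arg p) * Re (worm_arg_deriv p b)
        + Im (b $ 1) * sin (worm_arg p) + Im (p $ 1) * cos (worm_arg p) * Re (worm_arg_deriv p b))
      - 2 * (Re (p $ 1) * Re (b $ 1) + Im (p $ 1) * Im (b $ 1))
      - \<eta>1 (worm_arg p) * Re (worm_arg_deriv p b)"

lemma worm_domain_eq_height: "worm_domain \<eta> = {p. p $ 2 \<noteq> 0 \<and> worm_height \<eta> p > 0}"
proof -
  have "(cmod (z - exp (\<i> * of_real s)))\<^sup>2 =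
      (Re z * Re z + Im z * Im z) - 2 * (Re z * cos s + Im z * sin s) + ((sin s)\<^sup>2 + (cos s)\<^sup>2)" for z s
  proof -
    have "(cmod (z - exp (\<i> * of_real s)))\<^sup>2 = (Re z - cos s)\<^sup>2 + (Im z - sin s)\<^sup>2"
      by (simp add: cmod_power2 Re_exp Im_exp)
    also have "\<dots> = (Re z * Re z + Im z * Im z) - 2 * (Re z * cos s + Im z * sin s)
        + ((sin s)\<^sup>2 + (cos s)\<^sup>2)" by algebra
    finally show ?thesis .
  qed
  then show ?thesis
    by (auto simp: worm_domain_def worm_height_def worm_arg_def)
qed

lemma worm_arg_deriv_i: "worm_arg_deriv p (\<i> *s b) = \<i> * worm_arg_deriv p b"
  by (simp add: worm_arg_deriv_def)

text \<open>As s is pluriharmonic, only the term with the second derivative of \<open>h\<close>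
  survives.\<close>

lemma has_levi_compose_worm_arg:
  assumes "\<And>t. (h has_real_derivative h1 t) (at t)" "\<And>t. (h1 has_real_derivative h2 t) (at t)"
    "continuous_on UNIV h2"
  shows "has_levi {p. p $ 2 \<noteq> 0} (\<lambda>p. h (worm_arg p)) (\<lambda>p b. h1 (worm_arg p) * Re (worm_arg_deriv p b))
    (\<lambda>p b. h2 (worm_arg p) * (cmod (worm_arg_deriv p b))\<^sup>2)"
proof -
  have "has_levi {p. p $ 2 \<noteq> 0} worm_arg (\<lambda>p b. Re (worm_arg_deriv p b)) (\<lambda>p b. 0)"
    unfolding worm_arg_def[abs_def] worm_arg_deriv_def by (rule has_levi_ln_norm_square)
  from has_levi_compose[OF this subset_UNIV assms] show ?thesis
    by (rule has_levi_eq_rhs) (simp_all add: worm_arg_deriv_i cmod_power2)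
qed

text \<open>Let \<open>t\<close> be the harmonic conjugate of \<open>s = worm_arg p\<close>. Then \<open>exp t * worm_height \<eta> p\<close> is
  \<open>2 Re (z exp (t - \<i> s)) - |z exp (t/2 - \<i> s/2)|\<^sup>2 - exp t * \<eta> s\<close>, the real part of a holomorphic
  function minus plurisubharmonic ones. The formula below is its Levi form rewritten without
  the multivalued \<open>t\<close>.\<close>

lemma has_levi_worm_height:
  assumes eta: "\<And>x. (\<eta> has_real_derivative \<eta>1 x) (at x)"
    "\<And>x. (\<eta>1 has_real_derivative \<eta>2 x) (at x)" "continuous_on UNIV \<eta>2"
  shows "has_levi {p. p $ 2 \<noteq> 0} (worm_height \<eta>) (worm_height_deriv \<eta>1)
    (\<lambda>p b. - 2 * (worm_height_deriv \<eta>1 p b * Im (worm_arg_deriv p b)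
                + worm_height_deriv \<eta>1 p (\<i> *s b) * Re (worm_arg_deriv p b))
      - worm_height \<eta> p * (cmod (worm_arg_deriv p b))\<^sup>2
      - (\<eta> (worm_arg p) + \<eta>2 (worm_arg p)) * (cmod (worm_arg_deriv p b))\<^sup>2
      - (cmod (2 * b $ 1 - \<i> * p $ 1 * worm_arg_deriv p b))\<^sup>2)"
proof -
  let ?U = "{p :: complex ^ 2. p $ 2 \<noteq> 0}"
  have C: "has_levi ?U (\<lambda>p. cos (worm_arg p)) (\<lambda>p b. - sin (worm_arg p) * Re (worm_arg_deriv p b))
      (\<lambda>p b. - cos (worm_arg p) * (cmod (worm_arg_deriv p b))\<^sup>2)"
    by (rule has_levi_compose_worm_arg) (auto intro!: derivative_eq_intros continuous_intros)
  have S: "has_levi ?U (\<lambda>p. sin (worm_arg p)) (\<lambda>p b. cos (worm_arg p) * Re (worm_arg_deriv p b))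
      (\<lambda>p b. - sin (worm_arg p) * (cmod (worm_arg_deriv p b))\<^sup>2)"
    by (rule has_levi_compose_worm_arg) (auto intro!: derivative_eq_intros continuous_intros)
  have fn: "worm_height \<eta> = (\<lambda>p. 2 * (Re (p $ 1) * cos (worm_arg p) + Im (p $ 1) * sin (worm_arg p)) +
      (- 1 * (Re (p $ 1) * Re (p $ 1) + Im (p $ 1) * Im (p $ 1)) + - 1 * \<eta> (worm_arg p)))"
    by (simp add: fun_eq_iff worm_height_def)
  show ?thesis
    unfolding fn
  proof (rule has_levi_eq_rhs[OF has_levi_add[OF has_levi_cmult[OF has_levi_add[OF
      has_levi_mult[OF has_levi_Re_nth C] has_levi_mult[OF has_levi_Im_nth S]]]
      has_levi_add[OF has_levi_cmult[OF has_levi_add[OF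
      has_levi_mult[OF has_levi_Re_nth has_levi_Re_nth] has_levi_mult[OF has_levi_Im_nth has_levi_Im_nth]]]
        has_levi_cmult[OF has_levi_compose_worm_arg[OF eta]]]]], goal_cases)
    case (1 p b)
    then show ?case by (simp add: worm_height_deriv_def algebra_simps)
  next
    case (2 p b)
    have i1: "(\<i> *s b) $ 1 = \<i> * b $ 1" by simp
    show ?case
      unfolding worm_height_deriv_def worm_arg_deriv_i cmod_power2 i1
      by (simp add: power2_eq_square algebra_simps)
  qed
qed

text \<open>One completes the square in the gradient \<open>(r1 - r \<psi>1 g, r2 + r \<psi>1 h)\<close> of the weighted
  function; the remainder is nonnegative by the Riccati inequality for \<open>\<psi>1\<close>.\<close>

lemma riccati_inequality:
  fixes r E M r1 r2 lr g h e \<psi>1 \<psi>2 \<tau> :: real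
  defines "\<mu> \<equiv> \<tau> / (1 - \<tau>)"
  assumes tau: "\<tau> < 1" and r: "r > 0"
    and lr: "lr \<le> - 2 * (r1 * h + r2 * g) - r * (g\<^sup>2 + h\<^sup>2) - e * (g\<^sup>2 + h\<^sup>2)"
    and ric: "e + r * (\<psi>2 - \<mu> * (1 + \<psi>1\<^sup>2)) \<ge> 0"
  shows "(1 - \<tau>) * ((r1 - r * \<psi>1 * g)\<^sup>2 + (r2 + r * \<psi>1 * h)\<^sup>2)
    - r * (lr + r * (\<psi>1\<^sup>2 - \<psi>2) * (g\<^sup>2 + h\<^sup>2) - 2 * \<psi>1 * (r1 * g - r2 * h)) \<ge> 0"
proof -
  define G where "G = g\<^sup>2 + h\<^sup>2"
  define m1 where "m1 = r1 - r * \<psi>1 * g"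
  define m2 where "m2 = r2 + r * \<psi>1 * h"
  \<comment> \<open>When \<open>r1\<close>, \<open>r2\<close> are expressed by \<open>m1\<close>,
    \<open>m2\<close>, the terms linear in these become
    \<open>2 * r * (m1 * v1 + m2 * v2)\<close>.\<close>
  define v1 where "v1 = \<psi>1 * g + h"
  define v2 where "v2 = g - \<psi>1 * h"
  define k where "k = 1 - \<tau>"
  \<comment> \<open>Completing the square costs r^2 |v|^2 / k = (1 + \<mu>) r^2 |v|^2. One copy is
    already present in the expression, so the deficit is \<mu> times the square; this is the origin
    of \<mu>.\<close>
  have k: "k > 0" "1 + \<mu> = 1 / k" using tau by (simp_all add: k_def \<mu>_def field_simps)
  have vv: "v1\<^sup>2 + v2\<^sup>2 = (1 + \<psi>1\<^sup>2) * G"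
    by (simp add: v1_def v2_def G_def power2_eq_square algebra_simps)
  have "0 \<le> ((k * m1 + r * v1)\<^sup>2 + (k * m2 + r * v2)\<^sup>2) / k" using k by simp
  also have "\<dots> = k * (m1\<^sup>2 + m2\<^sup>2) + 2 * r * (m1 * v1 + m2 * v2) + r\<^sup>2 * (v1\<^sup>2 + v2\<^sup>2) * (1 / k)"
    using k by (simp add: power2_eq_square field_simps)
  also have "\<dots> = k * (m1\<^sup>2 + m2\<^sup>2) + 2 * r * (m1 * v1 + m2 * v2) + r\<^sup>2 * ((1 + \<psi>1\<^sup>2) * G) * (1 + \<mu>)"
    by (simp only: vv k(2))
  finally have sq: "0 \<le> k * (m1\<^sup>2 + m2\<^sup>2) + 2 * r * (m1 * v1 + m2 * v2) + r\<^sup>2 * ((1 + \<psi>1\<^sup>2) * G) * (1 + \<mu>)" .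
  have "r * G * (e + r * (\<psi>2 - \<mu> * (1 + \<psi>1\<^sup>2))) \<ge> 0"
    using r ric by (intro mult_nonneg_nonneg) (auto simp: G_def)
  moreover have "r * lr \<le> r * (- 2 * (r1 * h + r2 * g) - r * G - e * G)"
    using r lr by (intro mult_left_mono) (auto simp: G_def)
  moreover have "k * (m1\<^sup>2 + m2\<^sup>2)
      - r * ((- 2 * (r1 * h + r2 * g) - r * G - e * G) + r * (\<psi>1\<^sup>2 - \<psi>2) * G - 2 * \<psi>1 * (r1 * g - r2 * h))
     = (k * (m1\<^sup>2 + m2\<^sup>2) + 2 * r * (m1 * v1 + m2 * v2) + r\<^sup>2 * ((1 + \<psi>1\<^sup>2) * G) * (1 + \<mu>))
       + r * G * (e + r * (\<psi>2 - \<mu> * (1 + \<psi>1\<^sup>2)))"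
    unfolding m1_def m2_def v1_def v2_def G_def by (simp add: power2_eq_square algebra_simps)
  ultimately have "0 \<le> k * (m1\<^sup>2 + m2\<^sup>2)
      - (r * lr + r * (r * (\<psi>1\<^sup>2 - \<psi>2) * G - 2 * \<psi>1 * (r1 * g - r2 * h)))"
    using sq by (simp add: algebra_simps)
  then show ?thesis
    by (simp add: k_def m1_def m2_def G_def algebra_simps)
qed

text \<open>The Levi form of the power is \<open>- \<tau> * q p powr (\<tau> - 2)\<close> times the
  expression in the premise. With an exponent above 1 the lemma serves only to provide the two
  derivatives.\<close>

lemma has_levi_powr_nonpos:
  fixes q :: "complex ^ 'n::finite \<Rightarrow> real"
  assumes q: "has_levi U q d l" and pos: "\<And>p. p \<in> U \<Longrightarrow> q p > 0" and tau: "0 < \<tau>"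
  obtains d' l' where "has_levi U (\<lambda>p. q p powr \<tau>) d' l'"
    "\<And>p b. p \<in> U \<Longrightarrow> (1 - \<tau>) * ((d p b)\<^sup>2 + (d p (\<i> *s b))\<^sup>2) - q p * l p b \<ge> 0 \<Longrightarrow> l' p b \<le> 0"
proof -
  have "has_levi U (\<lambda>p. q p powr \<tau>) (\<lambda>p b. \<tau> * q p powr (\<tau> - 1) * d p b)
    (\<lambda>p b. \<tau> * (\<tau> - 1) * q p powr (\<tau> - 1 - 1) * ((d p b)\<^sup>2 + (d p (\<i> *s b))\<^sup>2)
      + \<tau> * q p powr (\<tau> - 1) * l p b)"
    by (rule has_levi_compose[OF q, of "{0<..}" "\<lambda>t. t powr \<tau>" "\<lambda>t. \<tau> * t powr (\<tau> - 1)"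
        "\<lambda>t. \<tau> * (\<tau> - 1) * t powr (\<tau> - 1 - 1)"])
      (use pos in \<open>auto intro!: derivative_eq_intros continuous_intros\<close>)
  moreover have "\<tau> * (\<tau> - 1) * q p powr (\<tau> - 1 - 1) * ((d p b)\<^sup>2 + (d p (\<i> *s b))\<^sup>2)
      + \<tau> * q p powr (\<tau> - 1) * l p b \<le> 0"
    if p: "p \<in> U" and nn: "(1 - \<tau>) * ((d p b)\<^sup>2 + (d p (\<i> *s b))\<^sup>2) - q p * l p b \<ge> 0" for p b
  proof -
    have e: "q p powr (\<tau> - 1) = q p powr (\<tau> - 1 - 1) * q p"
      using pos[OF p] powr_add[of "q p" "\<tau> - 1 - 1" 1] by simp
    have "0 \<le> \<tau> * q p powr (\<tau> - 1 - 1) * ((1 - \<tau>) * ((d p b)\<^sup>2 + (d p (\<i> *s b))\<^sup>2) - q p * l p b)"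
      using nn tau by (intro mult_nonneg_nonneg) auto
    then show ?thesis unfolding e by (simp add: algebra_simps)
  qed
  ultimately show ?thesis using that by blast
qed

section \<open>The concave cut-off\<close>

text \<open>A twice integrated tent function: concave, \<open>C\<^sup>2\<close>, the identity up to \<open>1\<close> and constant from
  \<open>3\<close> on. It discards the part of the domain far from the boundary without
  changing the defining function near the boundary.\<close>

definition ramp :: "real \<Rightarrow> real" where
  "ramp v = 2 - ((max 0 (3 - v))^3 - 2 * (max 0 (2 - v))^3 + (max 0 (1 - v))^3) / 6"

definition ramp1 :: "real \<Rightarrow> real" where
  "ramp1 v = ((max 0 (3 - v))\<^sup>2 - 2 * (max 0 (2 - v))\<^sup>2 + (max 0 (1 - v))\<^sup>2) / 2"

definition ramp2 :: "real \<Rightarrow> real" where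
  "ramp2 v = - (max 0 (3 - v) - 2 * max 0 (2 - v) + max 0 (1 - v))"

lemma max_0_power_derivative:
  assumes "n \<ge> 2"
  shows "((\<lambda>x::real. (max 0 x)^n) has_real_derivative real n * (max 0 x)^(n - 1)) (at x)"
proof (cases "x = 0")
  case True
  have "((\<lambda>h. (max 0 h)^n / h) \<longlongrightarrow> 0) (at (0::real))"
  proof (rule Lim_null_comparison)
    show "\<forall>\<^sub>F h in at (0::real). norm ((max 0 h)^n / h) \<le> \<bar>h\<bar>^(n-1)"
    proof (rule always_eventually, rule allI)
      fix h :: real
      show "norm ((max 0 h)^n / h) \<le> \<bar>h\<bar>^(n-1)"
      proof (cases "h > 0")
        case False
        then have "max 0 h = 0" by simp
        then show ?thesis using assms by (simp add: zero_power)
      qed (use assms in \<open>simp add: power_diff\<close>)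
    qed
    have "((\<lambda>h::real. \<bar>h\<bar>^(n-1)) \<longlongrightarrow> \<bar>0\<bar>^(n-1)) (at 0)"
      by (intro tendsto_intros)
    then show "((\<lambda>h::real. \<bar>h\<bar>^(n-1)) \<longlongrightarrow> 0) (at 0)"
      using assms by (simp add: zero_power)
  qed
  then show ?thesis
    using True assms by (simp add: DERIV_def zero_power)
next
  case False
  then consider "x > 0" | "x < 0" by linarith
  then show ?thesis
  proof cases
    case 1
    have "((\<lambda>x::real. x^n) has_real_derivative real n * (max 0 x)^(n - 1)) (at x)"
      using 1 by (auto intro!: derivative_eq_intros)
    then show ?thesis
      by (rule has_field_derivative_transform_within_open[of _ _ _ "{0<..}"]) (use 1 in auto)
  next
    case 2
    have "((\<lambda>x::real. 0) has_real_derivative real n * (max 0 x)^(n - 1)) (at x)"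
      using 2 assms by (auto intro!: derivative_eq_intros simp: zero_power)
    then show ?thesis
      by (rule has_field_derivative_transform_within_open[of _ _ _ "{..<0}"])
        (use 2 assms in \<open>auto simp: zero_power\<close>)
  qed
qed

lemma max_0_diff_power_derivative:
  assumes "n \<ge> 2"
  shows "((\<lambda>v::real. (max 0 (a - v))^n) has_real_derivative - (real n * (max 0 (a - v))^(n - 1))) (at v)"
proof -
  have "((\<lambda>v. a - v) has_real_derivative - 1) (at v)"
    by (auto intro!: derivative_eq_intros)
  from DERIV_chain2[where f = "\<lambda>x. (max 0 x)^n" and g = "\<lambda>v. a - v",
      OF max_0_power_derivative[OF assms] this]
  show ?thesis by simp
qed

lemma ramp_deriv: "(ramp has_real_derivative ramp1 v) (at v)"
  unfolding ramp_def[abs_def] ramp1_def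
  by (rule max_0_diff_power_derivative derivative_eq_intros refl | simp)+ (simp add: field_simps)

lemma ramp1_deriv: "(ramp1 has_real_derivative ramp2 v) (at v)"
  unfolding ramp1_def[abs_def] ramp2_def
  by (rule max_0_diff_power_derivative derivative_eq_intros refl | simp)+

lemma ramp2_cont: "continuous_on S ramp2"
  unfolding ramp2_def[abs_def] by (intro continuous_intros)

lemma ramp1_nonneg: "ramp1 v \<ge> 0"
proof -
  consider "v \<le> 1" | "1 \<le> v" "v \<le> 2" | "2 \<le> v" by linarith
  then show ?thesis
  proof cases
    case 1
    then show ?thesis by (simp add: ramp1_def power2_eq_square algebra_simps)
  next
    case 2
    have "2 * (2 - v)\<^sup>2 \<le> (3 - v)\<^sup>2"
    proof -
      have "(3 - v)\<^sup>2 - 2 * (2 - v)\<^sup>2 = (2 - v) * v + 1"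
        by (simp add: power2_eq_square algebra_simps) 
      then show ?thesis using 2 by (smt (verit) mult_nonneg_nonneg)
    qed
    with 2 show ?thesis by (simp add: ramp1_def)
  next
    case 3
    then show ?thesis by (simp add: ramp1_def)
  qed
qed

lemma ramp2_nonpos: "ramp2 v \<le> 0"
  by (simp add: ramp2_def max_def)

lemma ramp_eq_id: "v \<le> 1 \<Longrightarrow> ramp v = v"
  by (simp add: ramp_def power3_eq_cube field_simps)

lemma ramp1_eq_0: "3 \<le> v \<Longrightarrow> ramp1 v = 0"
  by (simp add: ramp1_def)

lemma ramp_pos: "0 < v \<Longrightarrow> 0 < ramp v"
proof (cases "v \<le> 1")
  case False
  have "ramp 1 \<le> ramp v"
    by (rule DERIV_nonneg_imp_nondecreasing) (use False ramp_deriv ramp1_nonneg in auto)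
  then show ?thesis by (simp add: ramp_eq_id)
qed (simp add: ramp_eq_id)

section \<open>The weighted height\<close>

text \<open>Convexity between 0, where \<eta> vanishes, and |s|. It lets a bound at a single point
  control \<eta> everywhere further out.\<close>

lemma worm_profile_mono:
  assumes eta: "worm_profile \<beta> \<eta>" and t: "0 < t" "t \<le> \<bar>s\<bar>" and beta: "pi / 2 < \<beta>"
  shows "\<eta> t \<le> \<eta> s"
proof -
  have s: "\<bar>s\<bar> > 0" using t by linarith
  have "convex_on UNIV \<eta>" and ev: "\<eta> \<bar>s\<bar> = \<eta> s"
    using eta by (auto simp: worm_profile_def abs_if)
  then have "\<eta> ((1 - t / \<bar>s\<bar>) *\<^sub>R 0 + (t / \<bar>s\<bar>) *\<^sub>R \<bar>s\<bar>) \<le> (1 - t / \<bar>s\<bar>) * \<eta> 0 + (t / \<bar>s\<bar>) * \<eta> \<bar>s\<bar>"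
    using t s by (intro convex_onD) auto
  moreover have "\<eta> 0 = 0" using worm_profile_zero_iff[OF eta] beta by simp
  ultimately have "\<eta> t \<le> (t / \<bar>s\<bar>) * \<eta> s" using s ev by simp
  also have "\<dots> \<le> 1 * \<eta> s"
    using t s worm_profile_nonneg[OF eta] by (intro mult_right_mono) (auto simp: divide_le_eq)
  finally show ?thesis by simp
qed

text \<open>The weight \<open>C powr (1/\<mu>) = exp (- \<psi>)\<close> comes from the Riccati equation
  \<open>\<psi>'' = \<mu> (1 + \<psi>'\<^sup>2)\<close>, that is, \<open>C'' + \<mu>\<^sup>2 C = 0\<close>. The summand \<open>K \<eta>\<close> keeps \<open>C\<close> positive;
  where it is not zero, the term \<open>\<eta> + \<eta>''\<close> in the Levi form of the height compensates
  for it as long as the height is small.\<close>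

lemma worm_weight_levi:
  fixes \<eta> \<eta>1 \<eta>2 C :: "real \<Rightarrow> real" and \<tau> K M :: real
  defines "\<mu> \<equiv> \<tau> / (1 - \<tau>)"
  defines "q \<equiv> \<lambda>p. M * (worm_height \<eta> p * exp (ln (C (worm_arg p)) / \<mu>))"
  assumes tau: "0 < \<tau>" "\<tau> < 1" and K: "K \<ge> 0"
    and eta: "\<And>x. \<eta> x \<ge> 0" "\<And>x. \<eta>2 x \<ge> 0" "\<And>x. (\<eta> has_real_derivative \<eta>1 x) (at x)"
      "\<And>x. (\<eta>1 has_real_derivative \<eta>2 x) (at x)" "continuous_on UNIV \<eta>2"
    and C_def: "\<And>t. C t = cos (\<mu> * t) + K * \<eta> t" and Cpos: "\<And>t. C t > 0"
  obtains d l where "has_levi {p. p $ 2 \<noteq> 0} q d l"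
    "\<And>p b. p $ 2 \<noteq> 0 \<Longrightarrow> worm_height \<eta> p > 0 \<Longrightarrow>
      worm_height \<eta> p * (K * max 1 (\<mu>\<^sup>2)) \<le> \<mu> * C (worm_arg p) \<Longrightarrow>
      (1 - \<tau>) * ((d p b)\<^sup>2 + (d p (\<i> *s b))\<^sup>2) - q p * l p b \<ge> 0"
    "\<And>p b. worm_height \<eta> p = 0 \<Longrightarrow>
      d p b = M * exp (ln (C (worm_arg p)) / \<mu>) * worm_height_deriv \<eta>1 p b"
proof -
  let ?U = "{p :: complex ^ 2. p $ 2 \<noteq> 0}"
  have mu: "\<mu> > 0" using tau by (simp add: \<mu>_def)
  define C1 where "C1 t = - \<mu> * sin (\<mu> * t) + K * \<eta>1 t" for t
  define C2 where "C2 t = - \<mu>\<^sup>2 * cos (\<mu> * t) + K * \<eta>2 t" for t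
  have dC: "(C has_real_derivative C1 t) (at t)" for t
    unfolding C_def[abs_def] C1_def by (auto intro!: derivative_eq_intros eta)
  have dC1: "(C1 has_real_derivative C2 t) (at t)" for t
    unfolding C1_def[abs_def] C2_def
    by (auto intro!: derivative_eq_intros eta simp: power2_eq_square)
  have cC: "continuous_on UNIV C" "continuous_on UNIV C1" "continuous_on UNIV C2"
    by (rule DERIV_continuous_on[OF has_field_derivative_at_within[OF dC]],
        rule DERIV_continuous_on[OF has_field_derivative_at_within[OF dC1]])
      (unfold C2_def[abs_def], intro continuous_intros eta)
  \<comment> \<open>The first two derivatives of \<psi> = - ln C / \<mu>; \<open>E\<close> is exp
    (-\<psi>).\<close>
  define \<psi>1 where "\<psi>1 t = - C1 t / (\<mu> * C t)" for t
  define \<psi>2 where "\<psi>2 t = - (C2 t * C t - (C1 t)\<^sup>2) / (\<mu> * (C t)\<^sup>2)" for t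
  define E where "E t = exp (ln (C t) / \<mu>)" for t
  have Cn: "C t \<noteq> 0" for t using Cpos[of t] by simp
  have dE: "(E has_real_derivative - \<psi>1 t * E t) (at t)" for t
    unfolding E_def[abs_def] \<psi>1_def using Cpos[of t] mu
    by (auto intro!: derivative_eq_intros dC simp: mult.commute)
  have d\<psi>: "(\<psi>1 has_real_derivative \<psi>2 t) (at t)" for t
  proof -
    have "(\<psi>1 has_real_derivative
        (- C2 t * (\<mu> * C t) - - C1 t * (\<mu> * C1 t)) / (\<mu> * C t * (\<mu> * C t))) (at t)"
      unfolding \<psi>1_def[abs_def] using Cn[of t] mu
      by (intro DERIV_divide DERIV_minus DERIV_cmult dC dC1) simp
    moreover have "(- C2 t * (\<mu> * C t) - - C1 t * (\<mu> * C1 t)) / (\<mu> * C t * (\<mu> * C t)) = \<psi>2 t"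
    proof -
      have "- C2 t * (\<mu> * C t) - - C1 t * (\<mu> * C1 t) = \<mu> * - (C2 t * C t - (C1 t)\<^sup>2)"
        "\<mu> * C t * (\<mu> * C t) = \<mu> * (\<mu> * (C t)\<^sup>2)"
        by (simp_all add: power2_eq_square algebra_simps)
      then show ?thesis
        unfolding \<psi>2_def using mu by (simp only: mult_divide_mult_cancel_left_if) simp
    qed
    ultimately show ?thesis by simp
  qed
  have dE1: "((\<lambda>t. - \<psi>1 t * E t) has_real_derivative ((\<psi>1 t)\<^sup>2 - \<psi>2 t) * E t) (at t)" for t
    by (auto intro!: derivative_eq_intros dE d\<psi> simp: power2_eq_square algebra_simps)
  have cE2: "continuous_on UNIV (\<lambda>t. ((\<psi>1 t)\<^sup>2 - \<psi>2 t) * E t)"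
    unfolding \<psi>1_def \<psi>2_def E_def using Cpos mu Cn
    by (auto intro!: continuous_intros cC)
  let ?s = worm_arg and ?\<gamma> = worm_arg_deriv
  define dr where "dr = worm_height_deriv \<eta>1"
  define lr where "lr p b = - 2 * (dr p b * Im (?\<gamma> p b) + dr p (\<i> *s b) * Re (?\<gamma> p b))
      - worm_height \<eta> p * (cmod (?\<gamma> p b))\<^sup>2
      - (\<eta> (?s p) + \<eta>2 (?s p)) * (cmod (?\<gamma> p b))\<^sup>2
      - (cmod (2 * b $ 1 - \<i> * p $ 1 * ?\<gamma> p b))\<^sup>2" for p b
  have r: "has_levi ?U (worm_height \<eta>) dr lr"
    using has_levi_worm_height[OF eta(3-5)] unfolding lr_def dr_def .
  have HE: "has_levi ?U (\<lambda>p. E (?s p)) (\<lambda>p b. - \<psi>1 (?s p) * E (?s p) * Re (?\<gamma> p b))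
      (\<lambda>p b. ((\<psi>1 (?s p))\<^sup>2 - \<psi>2 (?s p)) * E (?s p) * (cmod (?\<gamma> p b))\<^sup>2)"
    by (rule has_levi_compose_worm_arg[OF dE dE1 cE2])
  note Hq = has_levi_cmult[OF has_levi_mult[OF r HE], of M]
  define d where "d p b = M * (worm_height \<eta> p * (- \<psi>1 (?s p) * E (?s p) * Re (?\<gamma> p b)) + E (?s p) * dr p b)"
    for p b
  define l where "l p b = M * (worm_height \<eta> p * (((\<psi>1 (?s p))\<^sup>2 - \<psi>2 (?s p)) * E (?s p) * (cmod (?\<gamma> p b))\<^sup>2)
     + E (?s p) * lr p b + 2 * (dr p b * (- \<psi>1 (?s p) * E (?s p) * Re (?\<gamma> p b))
     + dr p (\<i> *s b) * (- \<psi>1 (?s p) * E (?s p) * Re (?\<gamma> p (\<i> *s b)))))" for p b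
  have q: "has_levi ?U q d l"
    using Hq unfolding q_def E_def[symmetric] d_def l_def .
  have "(1 - \<tau>) * ((d p b)\<^sup>2 + (d p (\<i> *s b))\<^sup>2) - q p * l p b \<ge> 0"
    if p: "p $ 2 \<noteq> 0" and pos: "worm_height \<eta> p > 0"
      and small: "worm_height \<eta> p * (K * max 1 (\<mu>\<^sup>2)) \<le> \<mu> * C (?s p)" for p b
  proof -
    let ?r = "worm_height \<eta> p" and ?e = "\<eta> (?s p) + \<eta>2 (?s p)"
    let ?c = "C (?s p)"
    have c: "?c > 0" by (rule Cpos)
    \<comment> \<open>The defect in the Riccati equation is a multiple of the defect in the linear
      equation C'' + \<mu>^2 C = 0, and to the latter only the summand K \<eta> contributes.\<close>
    have "\<psi>2 (?s p) - \<mu> * (1 + (\<psi>1 (?s p))\<^sup>2) = - (C2 (?s p) + \<mu>\<^sup>2 * ?c) / (\<mu> * ?c)"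
      unfolding \<psi>1_def \<psi>2_def using c mu by (simp add: power2_eq_square field_simps)
    also have "C2 (?s p) + \<mu>\<^sup>2 * ?c = K * (\<eta>2 (?s p) + \<mu>\<^sup>2 * \<eta> (?s p))"
      by (simp add: C2_def C_def algebra_simps)
    finally have ric: "\<psi>2 (?s p) - \<mu> * (1 + (\<psi>1 (?s p))\<^sup>2) = - (K * (\<eta>2 (?s p) + \<mu>\<^sup>2 * \<eta> (?s p))) / (\<mu> * ?c)" .
    \<comment> \<open>The factor \<open>max 1 (\<mu>\<^sup>2)\<close> dominates the coefficients of
      both \<eta>'' and \<eta>, so the defect is bounded by the favourable term \<eta> + \<eta>''
      once the height is small.\<close>
    have "?r * (K * (\<eta>2 (?s p) + \<mu>\<^sup>2 * \<eta> (?s p))) \<le> ?r * (K * (max 1 (\<mu>\<^sup>2) * ?e))"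
    proof (intro mult_left_mono)
      have "1 * \<eta>2 (?s p) \<le> max 1 (\<mu>\<^sup>2) * \<eta>2 (?s p)" "\<mu>\<^sup>2 * \<eta> (?s p) \<le> max 1 (\<mu>\<^sup>2) * \<eta> (?s p)"
        by (intro mult_right_mono eta; simp)+
      then show "\<eta>2 (?s p) + \<mu>\<^sup>2 * \<eta> (?s p) \<le> max 1 (\<mu>\<^sup>2) * ?e" by (simp add: distrib_left)
    qed (use K pos in auto)
    also have "\<dots> = (?r * (K * max 1 (\<mu>\<^sup>2))) * ?e" by simp
    also have "\<dots> \<le> (\<mu> * ?c) * ?e"
      by (rule mult_right_mono[OF small]) (simp add: eta)
    finally have "?r * (K * (\<eta>2 (?s p) + \<mu>\<^sup>2 * \<eta> (?s p))) / (\<mu> * ?c) \<le> ?e"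
      using c mu by (simp add: divide_le_eq mult.commute)
    then have cond: "?e + ?r * (\<psi>2 (?s p) - \<mu> * (1 + (\<psi>1 (?s p))\<^sup>2)) \<ge> 0"
      unfolding ric by simp
    let ?g = "Re (?\<gamma> p b)" and ?h = "Im (?\<gamma> p b)"
    have lrle: "lr p b \<le> - 2 * (dr p b * ?h + dr p (\<i> *s b) * ?g) - ?r * (?g\<^sup>2 + ?h\<^sup>2) - ?e * (?g\<^sup>2 + ?h\<^sup>2)"
      unfolding lr_def cmod_power2[of "?\<gamma> p b"] by simp
    from riccati_inequality[OF tau(2) pos lrle cond[unfolded \<mu>_def]]
    have R: "0 \<le> (1 - \<tau>) * ((dr p b - ?r * \<psi>1 (?s p) * ?g)\<^sup>2 + (dr p (\<i> *s b) + ?r * \<psi>1 (?s p) * ?h)\<^sup>2)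
       - ?r * (lr p b + ?r * ((\<psi>1 (?s p))\<^sup>2 - \<psi>2 (?s p)) * (?g\<^sup>2 + ?h\<^sup>2)
         - 2 * \<psi>1 (?s p) * (dr p b * ?g - dr p (\<i> *s b) * ?h))" (is "0 \<le> ?R") .
    let ?A = "M * E (?s p)"
    have "d p b = ?A * (dr p b - ?r * \<psi>1 (?s p) * ?g)"
      "d p (\<i> *s b) = ?A * (dr p (\<i> *s b) + ?r * \<psi>1 (?s p) * ?h)"
      "q p = ?A * ?r"
      "l p b = ?A * (lr p b + ?r * ((\<psi>1 (?s p))\<^sup>2 - \<psi>2 (?s p)) * (?g\<^sup>2 + ?h\<^sup>2)
         - 2 * \<psi>1 (?s p) * (dr p b * ?g - dr p (\<i> *s b) * ?h))"
      unfolding d_def l_def q_def E_def[symmetric] worm_arg_deriv_i cmod_power2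
      by (simp_all add: algebra_simps)
    moreover have "(1 - \<tau>) * ((A * m1)\<^sup>2 + (A * m2)\<^sup>2) - A * x * (A * y) =
        A\<^sup>2 * ((1 - \<tau>) * (m1\<^sup>2 + m2\<^sup>2) - x * y)" for A m1 m2 x y
      by (simp add: power2_eq_square algebra_simps)
    ultimately have "(1 - \<tau>) * ((d p b)\<^sup>2 + (d p (\<i> *s b))\<^sup>2) - q p * l p b = ?A\<^sup>2 * ?R"
      by (simp only:)
    then show ?thesis using R by simp
  qed
  moreover have "d p b = M * exp (ln (C (?s p)) / \<mu>) * worm_height_deriv \<eta>1 p b" if "worm_height \<eta> p = 0" for p b
    using that by (simp add: d_def E_def dr_def)
  ultimately show ?thesis using that[OF q] by blast
qed

lemma GDERIV_nonzero:
  fixes f :: "'a::euclidean_space \<Rightarrow> real"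
  assumes "(f has_derivative D) (at x)" "D b \<noteq> 0"
  shows "\<exists>g. GDERIV f x :> g \<and> g \<noteq> 0"
proof -
  from assms(1) have D: "linear D" by (simp add: has_derivative_linear)
  define g where "g = (\<Sum>i\<in>Basis. D i *\<^sub>R i)"
  have "D h = h \<bullet> g" for h
  proof -
    have "D h = D (\<Sum>i\<in>Basis. (h \<bullet> i) *\<^sub>R i)" by (simp add: euclidean_representation)
    also have "\<dots> = (\<Sum>i\<in>Basis. (h \<bullet> i) * D i)"
      by (simp add: linear_sum[OF D] linear_cmul[OF D])
    also have "\<dots> = h \<bullet> g" by (simp add: g_def inner_sum_right mult.commute)
    finally show ?thesis .
  qed
  then have "D = (\<lambda>h. h \<bullet> g)" by auto
  with assms show ?thesis by (auto simp: gderiv_def)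
qed

section \<open>The lower bound\<close>

theorem DF_exponent_worm:
  assumes beta: "pi / 2 < \<beta>" and eta: "worm_profile \<beta> \<eta>"
    and tau: "0 < \<tau>" "\<tau> < pi / (2 * \<beta>)"
  shows "DF_exponent (worm_domain \<eta>) \<tau>"
proof -
  let ?\<Omega> = "worm_domain \<eta>"
  let ?U = "{p :: complex ^ 2. p $ 2 \<noteq> 0}"
  let ?s = worm_arg
  define r where "r = worm_height \<eta>"
  have b0: "0 < \<beta>" using beta pi_gt_zero by linarith
  have tb: "2 * \<beta> * \<tau> < pi" using tau(2) b0 by (simp add: field_simps)
  have tau1: "\<tau> < 1"
  proof (rule ccontr)
    assume "\<not> \<tau> < 1"
    then have "2 * \<beta> * 1 \<le> 2 * \<beta> * \<tau>" using b0 by (intro mult_left_mono) auto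
    with tb beta show False by linarith
  qed
  define \<mu> where "\<mu> = \<tau> / (1 - \<tau>)"
  have mu: "\<mu> > 0" using tau tau1 by (simp add: \<mu>_def)
  \<comment> \<open>The first zero of cos (\<mu> t). The bound on \<tau> places it outside the
    interval where \<eta> vanishes, so \<eta> can take over from there.\<close>
  define s1 where "s1 = pi / (2 * \<mu>)"
  have s1: "s1 > \<beta> - pi / 2" "s1 > 0"
  proof -
    have "s1 = pi / (2 * \<tau>) - pi / 2"
      using tau tau1 by (simp add: s1_def \<mu>_def field_simps)
    moreover have "\<beta> < pi / (2 * \<tau>)" using tb tau by (simp add: field_simps)
    ultimately show "s1 > \<beta> - pi / 2" by simp
    show "s1 > 0" using mu by (simp add: s1_def)
  qed
  have mus1: "\<mu> * s1 = pi / 2" using mu by (simp add: s1_def)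
  have eta_s1: "\<eta> s1 > 0"
    using worm_profile_nonneg[OF eta, of s1] worm_profile_zero_iff[OF eta, of s1] s1 by auto
  \<comment> \<open>Beyond \<open>s1\<close> this makes K \<eta> at least 2, which outweighs a
    cosine of at least -1.\<close>
  define K where "K = 2 / \<eta> s1"
  have K: "K > 0" "K * \<eta> s1 = 2" using eta_s1 by (simp_all add: K_def)
  define C where "C t = cos (\<mu> * t) + K * \<eta> t" for t
  have Cpos: "C t > 0" for t
  proof (cases "\<bar>t\<bar> < s1")
    case True
    then have "\<mu> * \<bar>t\<bar> < pi / 2" using mu mus1 by (metis mult_less_cancel_left_pos)
    then have "\<bar>\<mu> * t\<bar> < pi / 2" using mu by (simp add: abs_mult)
    then have "cos (\<mu> * t) > 0" by (intro cos_gt_zero_pi) auto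
    moreover have "K * \<eta> t \<ge> 0" using K worm_profile_nonneg[OF eta] by simp
    ultimately show ?thesis by (simp add: C_def)
  next
    case False
    then have "K * \<eta> s1 \<le> K * \<eta> t"
      using K s1 worm_profile_mono[OF eta _ _ beta, of s1 t] by (intro mult_left_mono) auto
    then show ?thesis unfolding C_def using K(2) cos_ge_minus_one[of "\<mu> * t"] by linarith
  qed
  define E where "E t = exp (ln (C t) / \<mu>)" for t
  have Epos: "E t > 0" for t by (simp add: E_def)
  define Kc where "Kc = K * max 1 (\<mu>\<^sup>2)"
  have Kc: "Kc > 0" using K by (simp add: Kc_def)
  obtain a where a: "a > 0" "closure ?\<Omega> \<subseteq> {p. exp (- a) \<le> (cmod (p $ 2))\<^sup>2
      \<and> (cmod (p $ 2))\<^sup>2 \<le> exp a}"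
    using closure_worm_domain[OF eta] by blast
  have clU: "closure ?\<Omega> \<subseteq> ?U"
  proof
    fix p assume "p \<in> closure ?\<Omega>"
    then have "exp (- a) \<le> (cmod (p $ 2))\<^sup>2" using a(2) by blast
    moreover have "0 < exp (- a)" by simp
    ultimately show "p \<in> ?U" by auto
  qed
  have sa: "?s p \<in> {- a..a}" if "p \<in> ?\<Omega>" for p
  proof -
    have "p \<in> closure ?\<Omega>" using that closure_subset by blast
    then have p: "exp (- a) \<le> (cmod (p $ 2))\<^sup>2" "(cmod (p $ 2))\<^sup>2 \<le> exp a" "0 < (cmod (p $ 2))\<^sup>2"
      using a(2) clU by auto
    then have "- a \<le> ?s p" unfolding worm_arg_def by (subst ln_ge_iff) auto
    moreover have "?s p \<le> a"
      unfolding worm_arg_def using p by (metis ln_exp ln_mono)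
    ultimately show ?thesis by simp
  qed
  have contC: "continuous_on S C" for S
    unfolding C_def[abs_def]
    by (intro continuous_intros continuous_on_subset[OF DERIV_continuous_on[OF
        has_field_derivative_at_within[OF worm_profile_deriv[OF eta]]]]) auto
  have "continuous_on {-a..a} (\<lambda>t. \<mu> * C t * E t)"
    unfolding E_def using Cpos mu by (intro continuous_intros contC) (auto simp: less_le)
  then have "\<exists>t0\<in>{-a..a}. \<forall>t\<in>{-a..a}. \<mu> * C t0 * E t0 \<le> \<mu> * C t * E t"
    using a(1) by (intro continuous_attains_inf) auto
  then obtain t0 where t0: "\<And>t. t \<in> {-a..a} \<Longrightarrow> \<mu> * C t0 * E t0 \<le> \<mu> * C t * E t"
    by blast
  \<comment> \<open>Below this level \<open>r * E\<close> satisfies the smallness condition of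
    \<open>worm_weight_levi\<close>. The scaling \<open>M\<close> turns the level into
    \<open>q powr \<tau> = 3\<close>, the point where \<open>ramp\<close> becomes constant.\<close>
  define m where "m = \<mu> * C t0 * E t0 / Kc"
  have m: "m > 0" using mu Cpos Epos Kc by (simp add: m_def)
  define M where "M = 3 powr (1 / \<tau>) / m"
  have M: "M > 0" using m by (simp add: M_def)
  define q where "q p = M * (r p * exp (ln (C (?s p)) / \<mu>))" for p
  have qE: "q p = M * (r p * E (?s p))" for p by (simp add: q_def E_def)
  have q0: "q p > 0 \<longleftrightarrow> r p > 0" for p
    using M Epos[of "?s p"] by (simp add: qE zero_less_mult_iff)
  have Om: "?\<Omega> = {p \<in> ?U. q p > 0}"
    by (auto simp: worm_domain_eq_height q0 r_def)
  have eta2: "deriv (deriv \<eta>) x \<ge> 0" for x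
  proof (rule convex_on_imp_second_derivative_nonneg[of \<eta> "deriv \<eta>" "deriv (deriv \<eta>)"])
    show "convex_on UNIV \<eta>" using eta by (simp add: worm_profile_def)
  qed (rule worm_profile_deriv[OF eta] worm_profile_deriv2[OF eta])+
  obtain d l where L: "has_levi ?U q d l"
    "\<And>p b. p $ 2 \<noteq> 0 \<Longrightarrow> r p > 0 \<Longrightarrow> r p * Kc \<le> \<mu> * C (?s p) \<Longrightarrow>
      (1 - \<tau>) * ((d p b)\<^sup>2 + (d p (\<i> *s b))\<^sup>2) - q p * l p b \<ge> 0"
    "\<And>p b. r p = 0 \<Longrightarrow> d p b = M * E (?s p) * worm_height_deriv (deriv \<eta>) p b"
    unfolding q_def r_def Kc_def \<mu>_def E_def
    by (rule worm_weight_levi[where M = M, OF tau(1) tau1 less_imp_le[OF K(1)] worm_profile_nonneg[OF eta] eta2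
        worm_profile_deriv[OF eta] worm_profile_deriv2[OF eta] worm_profile_cont2[OF eta]
        C_def[unfolded \<mu>_def] Cpos]) blast
  have opU: "open ?U" by (intro open_Collect_neq continuous_intros)
  have openq: "open {p \<in> ?U. q p < c}" "open {p \<in> ?U. q p > c}" for c
    using continuous_open_preimage[OF has_levi_continuous_on[OF L(1)] opU open_lessThan[of c]]
      continuous_open_preimage[OF has_levi_continuous_on[OF L(1)] opU open_greaterThan[of c]]
    by (simp_all add: Collect_conj_eq vimage_def lessThan_def greaterThan_def Int_commute)
  have Lq: "has_levi ?\<Omega> q d l" by (rule has_levi_subset[OF L(1)]) (auto simp: Om)
  have qpos: "q p > 0" if "p \<in> ?\<Omega>" for p using that by (simp add: Om)
  obtain d' l' where V: "has_levi ?\<Omega> (\<lambda>p. q p powr \<tau>) d' l'"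
    "\<And>p b. p \<in> ?\<Omega> \<Longrightarrow> (1 - \<tau>) * ((d p b)\<^sup>2 + (d p (\<i> *s b))\<^sup>2) - q p * l p b \<ge> 0 \<Longrightarrow> l' p b \<le> 0"
    using has_levi_powr_nonpos[OF Lq qpos tau(1)] by blast
  have l': "l' p b \<le> 0" if p: "p \<in> ?\<Omega>" and lt: "q p powr \<tau> < 3" for p b
  proof (rule V(2)[OF p L(2)])
    show "p $ 2 \<noteq> 0" using p by (simp add: Om)
    show rp: "r p > 0" using qpos[OF p] q0 by simp
    have "q p = (q p powr \<tau>) powr (1 / \<tau>)" using qpos[OF p] tau by (simp add: powr_powr)
    also have "\<dots> < 3 powr (1 / \<tau>)" using lt tau by (intro powr_less_mono2) auto
    finally have "r p * E (?s p) < m" using m by (simp add: qE M_def field_simps)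
    also have "m \<le> \<mu> * C (?s p) * E (?s p) / Kc"
      unfolding m_def using t0[OF sa[OF p]] Kc by (intro divide_right_mono) auto
    finally have "r p * E (?s p) * Kc < \<mu> * C (?s p) * E (?s p)"
      using Kc by (simp add: pos_less_divide_eq)
    then have "E (?s p) * (r p * Kc) < E (?s p) * (\<mu> * C (?s p))" by (simp add: algebra_simps)
    then show "r p * Kc \<le> \<mu> * C (?s p)"
      using Epos[of "?s p"] by simp
  qed
  \<comment> \<open>The formula with \<open>ramp\<close> agrees with \<open>- q\<close> where 0 < q
    \<le> 1, but only \<open>- q\<close> continues smoothly across the boundary, since a power of a
    negative number is meaningless there. The value 1 keeps the points with w = 0 outside.\<close>
  define \<rho> where "\<rho> p = (if p $ 2 = 0 then 1 else if q p \<le> 1 then - q p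
      else - (ramp (q p powr \<tau>) powr (1 / \<tau>)))" for p
  have \<rho>_ramp: "\<rho> p = - (ramp (q p powr \<tau>) powr (1 / \<tau>))" if "p \<in> ?\<Omega>" for p
  proof (cases "q p \<le> 1")
    case True
    then have "q p powr \<tau> \<le> 1" using qpos[OF that] tau by (simp add: powr_le1)
    then show ?thesis using True that qpos[OF that] tau
      by (simp add: \<rho>_def Om ramp_eq_id powr_powr)
  qed (use that in \<open>simp add: \<rho>_def Om\<close>)
  have rpos: "ramp (q p powr \<tau>) > 0" if "p \<in> ?\<Omega>" for p
    using qpos[OF that] by (intro ramp_pos) simp
  have \<rho>_C2: "C2_on ?U \<rho>"
    unfolding C2_on_iff_jet2
  proof (rule jet2_glue)
    fix p assume p: "p \<in> ?U"
    have 1: "has_levi {p \<in> ?U. q p < 1} \<rho> (\<lambda>p b. - 1 * d p b) (\<lambda>p b. - 1 * l p b)"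
      by (rule has_levi_cong[OF has_levi_cmult[OF has_levi_subset[OF L(1)]] openq(1)])
        (auto simp: \<rho>_def)
    have Lr: "has_levi ?\<Omega> (\<lambda>p. ramp (q p powr \<tau>)) (\<lambda>p b. ramp1 (q p powr \<tau>) * d' p b)
        (\<lambda>p b. ramp2 (q p powr \<tau>) * ((d' p b)\<^sup>2 + (d' p (\<i> *s b))\<^sup>2) + ramp1 (q p powr \<tau>) * l' p b)"
      by (rule has_levi_compose[OF V(1) subset_UNIV ramp_deriv ramp1_deriv ramp2_cont])
    have it: "0 < 1 / \<tau>" using tau by simp
    obtain d2 l2 where "has_levi ?\<Omega> (\<lambda>p. ramp (q p powr \<tau>) powr (1 / \<tau>)) d2 l2"
      by (rule has_levi_powr_nonpos[OF Lr rpos it])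
    from has_levi_cmult[OF this, of "- 1"]
    have 2: "has_levi ?\<Omega> \<rho> (\<lambda>p b. - 1 * d2 p b) (\<lambda>p b. - 1 * l2 p b)"
      by (rule has_levi_cong[OF _ open_worm_domain[OF eta]]) (simp add: \<rho>_ramp)
    show "\<exists>V f' f''. open V \<and> p \<in> V \<and> jet2 V \<rho> f' f''"
    proof (cases "q p < 1")
      case True
      then show ?thesis using 1 openq(1)[of 1] p unfolding has_levi_def by blast
    next
      case False
      then have "p \<in> ?\<Omega>" using p by (simp add: Om)
      then show ?thesis using 2 open_worm_domain[OF eta] unfolding has_levi_def by blast
    qed
  qed
  have \<rho>_Om: "?\<Omega> = {p. \<rho> p < 0}"
  proof (intro equalityI subsetI CollectI)
    fix p assume "p \<in> ?\<Omega>"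
    then show "\<rho> p < 0" using rpos[of p] by (simp add: \<rho>_ramp)
  next
    fix p assume "p \<in> {p. \<rho> p < 0}"
    then show "p \<in> ?\<Omega>" by (auto simp: \<rho>_def Om split: if_splits)
  qed
  have grad: "\<exists>g. GDERIV \<rho> p :> g \<and> g \<noteq> 0" if p: "p \<in> frontier ?\<Omega>" for p
  proof -
    have pU: "p \<in> ?U" using p clU by (auto simp: frontier_def)
    have "p \<notin> ?\<Omega>"
      using p open_worm_domain[OF eta] by (simp add: frontier_def interior_open)
    then have "q p \<le> 0" using pU by (simp add: Om not_less)
    \<comment> \<open>The set q < 0 is open and disjoint from the domain, hence from its
      closure.\<close>
    moreover have "\<not> q p < 0"
    proof
      assume "q p < 0"
      moreover have "{p \<in> ?U. q p < 0} \<inter> closure ?\<Omega> = {}"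
        using openq(1)[of 0] by (subst open_Int_closure_eq_empty) (auto simp: Om)
      ultimately show False using pU p by (auto simp: frontier_def)
    qed
    ultimately have qp: "q p = 0" by simp
    then have rp: "r p = 0" using M Epos[of "?s p"] by (simp add: qE)
    obtain f' f'' where f: "jet2 ?U q f' f''" "\<And>b. f' p b = d p b"
      using L(1) pU unfolding has_levi_def by blast
    have der: "(\<rho> has_derivative (\<lambda>b. - d p b)) (at p)"
    proof (rule has_derivative_transform_within_open[OF _ openq(1)[of 1]])
      show "((\<lambda>p. - q p) has_derivative (\<lambda>b. - d p b)) (at p)"
        using has_derivative_minus[OF jet2_D1[OF f(1) pU]] by (simp add: f(2))
    qed (use pU qp in \<open>auto simp: \<rho>_def\<close>)
    \<comment> \<open>At the centre of the disc the z-derivative vanishes; there \<eta> = 1, the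
      profile has nonzero slope, and the direction w/2 gives s the derivative 1. Elsewhere, moving z
      towards the centre increases the height.\<close>
    have "\<exists>b. worm_height_deriv (deriv \<eta>) p b \<noteq> 0"
    proof (cases "Re (p $ 1) = cos (?s p) \<and> Im (p $ 1) = sin (?s p)")
      case True
      have "r p = 2 * (cos (?s p) * cos (?s p) + sin (?s p) * sin (?s p))
          - (cos (?s p) * cos (?s p) + sin (?s p) * sin (?s p)) - \<eta> (?s p)"
        using True by (simp add: r_def worm_height_def)
      also have "cos (?s p) * cos (?s p) + sin (?s p) * sin (?s p) = 1"
        using sin_cos_squared_add3[of "?s p"] by simp
      finally have "\<eta> (?s p) = 1" using rp by simp
      then have "deriv \<eta> (?s p) \<noteq> 0" using eta by (simp add: worm_profile_def)
      moreover have "worm_height_deriv (deriv \<eta>) p ((p $ 2 / 2) *s axis 2 1) = - deriv \<eta> (?s p)"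
        using pU True by (simp add: worm_height_deriv_def worm_arg_deriv_def axis_def)
      ultimately show ?thesis by (metis neg_equal_0_iff_equal)
    next
      case False
      let ?k = "cos (?s p) - Re (p $ 1)" and ?l = "sin (?s p) - Im (p $ 1)"
      have "worm_height_deriv (deriv \<eta>) p (Complex ?k ?l *s axis 1 1) =
          2 * (?k * cos (?s p) + ?l * sin (?s p)) - 2 * (Re (p $ 1) * ?k + Im (p $ 1) * ?l)"
        by (simp add: worm_height_deriv_def worm_arg_deriv_def axis_def)
      also have "\<dots> = 2 * (?k\<^sup>2 + ?l\<^sup>2)" by algebra
      finally have "worm_height_deriv (deriv \<eta>) p (Complex ?k ?l *s axis 1 1) = 2 * (?k\<^sup>2 + ?l\<^sup>2)" .
      moreover have "?k\<^sup>2 + ?l\<^sup>2 \<noteq> 0" using False by (auto simp: sum_power2_eq_zero_iff)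
      ultimately show ?thesis by (metis mult_eq_0_iff zero_neq_numeral)
    qed
    then obtain b where "- d p b \<noteq> 0" using L(3)[OF rp] M Epos[of "?s p"] by auto
    with der show ?thesis by (rule GDERIV_nonzero)
  qed
  have df: "defining_function ?\<Omega> \<rho>"
    unfolding defining_function_def using opU clU \<rho>_C2 \<rho>_Om grad by blast
  have "has_levi ?\<Omega> (\<lambda>p. - 1 * ramp (q p powr \<tau>)) (\<lambda>p b. - 1 * (ramp1 (q p powr \<tau>) * d' p b))
        (\<lambda>p b. - 1 * (ramp2 (q p powr \<tau>) * ((d' p b)\<^sup>2 + (d' p (\<i> *s b))\<^sup>2) + ramp1 (q p powr \<tau>) * l' p b))"
    by (intro has_levi_cmult has_levi_compose[OF V(1) subset_UNIV ramp_deriv ramp1_deriv ramp2_cont])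
  then have "has_levi ?\<Omega> (\<lambda>p. - ((- \<rho> p) powr \<tau>)) (\<lambda>p b. - 1 * (ramp1 (q p powr \<tau>) * d' p b))
        (\<lambda>p b. - 1 * (ramp2 (q p powr \<tau>) * ((d' p b)\<^sup>2 + (d' p (\<i> *s b))\<^sup>2) + ramp1 (q p powr \<tau>) * l' p b))"
    by (rule has_levi_cong[OF _ open_worm_domain[OF eta]])
      (use rpos tau in \<open>auto simp: \<rho>_ramp powr_powr less_imp_le\<close>)
  then obtain u' u'' where u: "jet2 ?\<Omega> (\<lambda>p. - ((- \<rho> p) powr \<tau>)) u' u''"
    and lev: "\<And>p b. p \<in> ?\<Omega> \<Longrightarrow> levi (u'' p) b =
      - 1 * (ramp2 (q p powr \<tau>) * ((d' p b)\<^sup>2 + (d' p (\<i> *s b))\<^sup>2) + ramp1 (q p powr \<tau>) * l' p b)"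
    unfolding has_levi_def by blast
  \<comment> \<open>Concavity of \<open>ramp\<close> handles the gradient term. The sign of
    \<open>l'\<close> is known only for \<open>q powr \<tau> < 3\<close>, and from 3 on its
    coefficient \<open>ramp1\<close> is 0.\<close>
  have "plurisubharmonic_on ?\<Omega> (\<lambda>p. - ((- \<rho> p) powr \<tau>))"
  proof (rule plurisubharmonic_on_jet2I[OF u])
    fix p b assume p: "p \<in> ?\<Omega>"
    have "ramp1 (q p powr \<tau>) * l' p b \<le> 0"
    proof (cases "q p powr \<tau> < 3")
      case True
      then show ?thesis using l'[OF p] ramp1_nonneg by (simp add: mult_nonneg_nonpos)
    qed (simp add: ramp1_eq_0)
    moreover have "ramp2 (q p powr \<tau>) * ((d' p b)\<^sup>2 + (d' p (\<i> *s b))\<^sup>2) \<le> 0"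
      using ramp2_nonpos by (simp add: mult_nonpos_nonneg)
    ultimately show "0 \<le> levi (u'' p) b" unfolding lev[OF p] by simp
  qed
  with df tau tau1 show ?thesis unfolding DF_exponent_def by blast
qed

theorem theorem4p4:
  fixes \<beta> :: real and \<eta> :: "real \<Rightarrow> real"
  assumes "\<beta> > pi / 2"
    and "worm_profile \<beta> \<eta>"
  shows "DF_index (worm_domain \<eta>) = ereal (pi / (2 * \<beta>))"
  unfolding DF_index_def
proof (rule SUP_eqI)
  fix \<tau> assume "\<tau> \<in> {\<tau>. DF_exponent (worm_domain \<eta>) \<tau>}"
  then show "ereal \<tau> \<le> ereal (pi / (2 * \<beta>))"
    using DF_exponent_worm_le[OF assms] by simp
next
  fix y :: ereal
  assume y: "\<And>\<tau>. \<tau> \<in> {\<tau>. DF_exponent (worm_domain \<eta>) \<tau>} \<Longrightarrow> ereal \<tau> \<le> y"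
  have pos: "0 < pi / (2 * \<beta>)"
  proof -
    have "0 < \<beta>" using assms(1) pi_gt_zero by linarith
    then show ?thesis by simp
  qed
  show "ereal (pi / (2 * \<beta>)) \<le> y"
  proof (rule ereal_le_real)
    fix z assume "y \<le> ereal z"
    have "\<tau> \<le> z" if "0 < \<tau>" "\<tau> < pi / (2 * \<beta>)" for \<tau>
    proof -
      have "ereal \<tau> \<le> y" using y DF_exponent_worm[OF assms that] by simp
      also note \<open>y \<le> ereal z\<close>
      finally show ?thesis by simp
    qed
    then have "pi / (2 * \<beta>) \<le> z" by (intro dense_le_bounded[OF pos]) auto
    then show "ereal (pi / (2 * \<beta>)) \<le> ereal z" by simp
  qed
qed

end
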